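(* Let $T$ be a tree of order $n\ge4$ which is not isomorphic to the star $K_{1,n-1}$. Then $\xi_1(T^c)\ge\xi_1(P_n^c)$, with equality if and only if $T\cong P_n$.
   Context: For a connected graph $G$, the eccentricity matrix $\mathcal{E}(G)$ is the matrix indexed by $V(G)$ whose $(u,v)$-entry is $d_G(u,v)$ if $d_G(u,v)=\min\{e_G(u),e_G(v)\}$ and $0$ otherwise, where $d_G$ is the graph distance and $e_G(u)=\max_v d_G(u,v)$. $\xi_1(G)$ denotes the largest eigenvalue of $\mathcal{E}(G)$. $T^c$ is the complement of $T$ (which is connected exactly when the tree $T$ is not a star), and $P_n$ is the path on $n$ vertices. *)

theory Defs
  imports
    "Graph_Theory.Graph_Theory"
    "Jordan_Normal_Form.Char_Poly"
begin

text \<open>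
  Finite simple graphs are rendered as in the entry Graph Theory: a \<^locale>\<open>pair_graph\<close> is a
  finite, loop-free digraph without parallel arcs whose arc set is symmetric, an edge being
  represented by its two opposite arcs.
\<close>

text \<open>
  The library predicate \<^const>\<open>tree\<close> cannot be used for a symmetric digraph: there every edge,
  traversed back and forth, is already a cycle of length 2.  The cycles of the undirected graph are
  exactly the cycles of length at least 3.
\<close>

definition undirected_tree :: "'a pair_pre_digraph \<Rightarrow> bool" where
  "undirected_tree T \<longleftrightarrow> pair_graph T \<and> Digraph_Component.connected (with_proj T) \<and>
     \<not> (\<exists>p. pre_digraph.cycle (with_proj T) p \<and> 3 \<le> length p)"

definition graph_complement :: "'a pair_pre_digraph \<Rightarrow> 'a pair_pre_digraph" where
  "graph_complement G =
     \<lparr>pverts = pverts G,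
      parcs = {(u, v). u \<in> pverts G \<and> v \<in> pverts G \<and> u \<noteq> v \<and> (u, v) \<notin> parcs G}\<rparr>"

definition path_graph :: "nat \<Rightarrow> nat pair_pre_digraph" where
  "path_graph n =
     \<lparr>pverts = {0..<n},
      parcs = {(i, j). i < n \<and> j < n \<and> (j = Suc i \<or> i = Suc j)}\<rparr>"

text \<open>
  The distance is the library's least cost of a walk, for unit weights.  It is \<open>\<infinity>\<close>, converted
  to the junk value 0, for vertices in different components; the definitions below are only
  meaningful for connected graphs.
\<close>

definition graph_dist :: "'a pair_pre_digraph \<Rightarrow> 'a \<Rightarrow> 'a \<Rightarrow> real" where
  "graph_dist G u v = real_of_ereal (wf_digraph.\<mu> (with_proj G) (\<lambda>_. 1) u v)"

definition eccentricity :: "'a pair_pre_digraph \<Rightarrow> 'a \<Rightarrow> real" where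
  "eccentricity G u = Max (graph_dist G u ` pverts G)"

definition ecc_entry :: "'a pair_pre_digraph \<Rightarrow> 'a \<Rightarrow> 'a \<Rightarrow> real" where
  "ecc_entry G u v =
     (if graph_dist G u v = min (eccentricity G u) (eccentricity G v) then graph_dist G u v else 0)"

text \<open>
  Library matrices are indexed by numbers, so the eccentricity matrix is taken with respect to
  an enumeration \<open>vs\<close> of the vertices.  Its spectrum does not depend on \<open>vs\<close>; see
  \<open>eigenvalue_ecc_mat_iff\<close> below.
\<close>

definition ecc_mat :: "'a list \<Rightarrow> 'a pair_pre_digraph \<Rightarrow> real mat" where
  "ecc_mat vs G = mat (length vs) (length vs) (\<lambda>(i, j). ecc_entry G (vs ! i) (vs ! j))"

definition ecc_spectrum :: "'a pair_pre_digraph \<Rightarrow> real set" where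
  "ecc_spectrum G =
     {x. \<exists>vs. distinct vs \<and> set vs = pverts G \<and> eigenvalue (ecc_mat vs G) x}"

definition xi1 :: "'a pair_pre_digraph \<Rightarrow> real" where
  "xi1 G = Max (ecc_spectrum G)"

lemma eigenvalue_ecc_mat_iff:
  assumes vs: "distinct vs" "set vs = pverts G"
  shows "eigenvalue (ecc_mat vs G) x \<longleftrightarrow>
    (\<exists>f. (\<exists>v\<in>pverts G. f v \<noteq> 0) \<and>
         (\<forall>u\<in>pverts G. (\<Sum>v\<in>pverts G. ecc_entry G u v * f v) = x * f u))"
proof -
  let ?n = "length vs"
  have bij: "bij_betw ((!) vs) {0..<?n} (pverts G)"
    using vs bij_betw_nth[of vs "{0..<?n}" "pverts G"] by (simp add: lessThan_atLeast0)
  have row: "(\<Sum>j = 0..<?n. ecc_entry G (vs ! i) (vs ! j) * f (vs ! j))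
      = (\<Sum>v\<in>pverts G. ecc_entry G (vs ! i) v * f v)" for i and f :: "'a \<Rightarrow> real"
    by (rule sum.reindex_bij_betw[OF bij])
  show ?thesis
  proof
    assume "eigenvalue (ecc_mat vs G) x"
    then obtain w where w: "w \<in> carrier_vec ?n" "w \<noteq> 0\<^sub>v ?n"
        "ecc_mat vs G *\<^sub>v w = x \<cdot>\<^sub>v w"
      by (auto simp: eigenvalue_def eigenvector_def ecc_mat_def)
    define f where "f v = w $ inv_into {0..<?n} ((!) vs) v" for v
    have f: "f (vs ! i) = w $ i" if "i < ?n" for i
      using that bij by (simp add: f_def bij_betw_def inv_into_f_f)
    have eq: "(\<Sum>v\<in>pverts G. ecc_entry G (vs ! i) v * f v) = x * f (vs ! i)"
      if i: "i < ?n" for i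
    proof -
      have "(ecc_mat vs G *\<^sub>v w) $ i = x * w $ i" using w i by simp
      moreover have "(ecc_mat vs G *\<^sub>v w) $ i
          = (\<Sum>j = 0..<?n. ecc_entry G (vs ! i) (vs ! j) * f (vs ! j))"
        using w(1) i by (auto simp: ecc_mat_def scalar_prod_def f intro!: sum.cong)
      ultimately show ?thesis using row[of i f] f[OF i] by simp
    qed
    obtain i where "i < ?n" "w $ i \<noteq> 0"
      using w(1,2) by (metis carrier_vecD eq_vecI index_zero_vec)
    then have "\<exists>v\<in>pverts G. f v \<noteq> 0" using f vs by (metis nth_mem)
    moreover have "\<forall>u\<in>pverts G. (\<Sum>v\<in>pverts G. ecc_entry G u v * f v) = x * f u"
      using eq vs by (metis in_set_conv_nth)
    ultimately show "\<exists>f. (\<exists>v\<in>pverts G. f v \<noteq> 0) \<and>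
         (\<forall>u\<in>pverts G. (\<Sum>v\<in>pverts G. ecc_entry G u v * f v) = x * f u)" by blast
  next
    assume "\<exists>f. (\<exists>v\<in>pverts G. f v \<noteq> 0) \<and>
         (\<forall>u\<in>pverts G. (\<Sum>v\<in>pverts G. ecc_entry G u v * f v) = x * f u)"
    then obtain f where f: "\<exists>v\<in>pverts G. f v \<noteq> 0"
      "\<forall>u\<in>pverts G. (\<Sum>v\<in>pverts G. ecc_entry G u v * f v) = x * f u" by blast
    define w where "w = vec ?n (\<lambda>i. f (vs ! i))"
    obtain i where i: "i < ?n" "f (vs ! i) \<noteq> 0" using f(1) vs by (metis in_set_conv_nth)
    have "w \<noteq> 0\<^sub>v ?n" using i by (metis w_def index_vec index_zero_vec(1))
    moreover have "ecc_mat vs G *\<^sub>v w = x \<cdot>\<^sub>v w"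
    proof (rule eq_vecI)
      fix i assume "i < dim_vec (x \<cdot>\<^sub>v w)"
      then have i: "i < ?n" by (simp add: w_def)
      have "(ecc_mat vs G *\<^sub>v w) $ i
          = (\<Sum>j = 0..<?n. ecc_entry G (vs ! i) (vs ! j) * f (vs ! j))"
        using i by (auto simp: ecc_mat_def scalar_prod_def w_def intro!: sum.cong)
      also have "\<dots> = x * f (vs ! i)" using row[of i f] f(2) vs i by (metis nth_mem)
      finally show "(ecc_mat vs G *\<^sub>v w) $ i = (x \<cdot>\<^sub>v w) $ i" using i by (simp add: w_def)
    qed (simp add: ecc_mat_def w_def)
    ultimately show "eigenvalue (ecc_mat vs G) x"
      unfolding eigenvalue_def eigenvector_def
      by (intro exI[of _ w]) (simp add: ecc_mat_def w_def)
  qed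
qed

end

theory Submission
  imports Defs "HOL-Analysis.Function_Topology"
begin

text \<open>
  For a tree \<open>T\<close> that is not a star, the eccentricity matrix of the complement dominates \<open>2 A(T)\<close>
  entrywise, and it equals \<open>2 A(T)\<close> when \<open>T\<close> is a path on at least five vertices.  So it suffices to
  find, for a tree with a vertex of degree at least three, a test vector whose Rayleigh quotient for
  \<open>A(T)\<close> exceeds \<open>2 cos \<theta>\<close>, where \<open>\<theta> = \<pi> / (n + 1)\<close>.  Root \<open>T\<close> and put
  \<open>g v = s m * g (parent v)\<close>, where \<open>m\<close> is the number of vertices below or at \<open>v\<close> and
  \<open>s m = sin (m \<theta>) / sin ((m + 1) \<theta>)\<close>.  Because \<open>s (m - 1) + 1 / s m = 2 cos \<theta>\<close> and \<open>s\<close> is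
  subadditive, \<open>A g \<ge> 2 cos \<theta> g\<close>, strictly at every vertex other than the root with at least two
  children.
\<close>

section \<open>Branch ratios\<close>

text \<open>The constants come from the path: the positive adjacency eigenvector of
  \<open>P_n\<close> has entries \<open>sin (k * \<theta>)\<close> for \<open>k\<close> from 1 to
  \<open>n\<close>, with eigenvalue \<open>2 * cos \<theta>\<close>, and \<open>s m\<close> is a
  quotient of consecutive entries. The root is the delicate place for strictness. The gain from
  splitting \<open>a + b\<close> vertices into two branches contains the factor
  \<open>sin ((a + b + 2) * \<theta>)\<close>, which is 0 at a root with two branches, where
  \<open>a + b + 2 = n + 1\<close>. The tree is therefore rooted at a neighbour of a vertex of
  degree at least three, which then has a parent and at least two children. Strictness at this one
  vertex suffices, because the test vector is positive and only Rayleigh quotients are compared.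
  Order four is exceptional: the complement of \<open>P_4\<close> has two vertices at distance 3,
  and \<open>4 * cos \<theta>\<close> is not its largest eigenvalue. A tree without branch vertex is
  a path, and equality is invariance under isomorphism.\<close>

definition branch_ratio :: "real \<Rightarrow> nat \<Rightarrow> real" where
  "branch_ratio \<theta> m = sin (real m * \<theta>) / sin (real (Suc m) * \<theta>)"

lemma branch_ratio_0 [simp]: "branch_ratio \<theta> 0 = 0"
  by (simp add: branch_ratio_def)

lemma branch_ratio_pos:
  assumes "0 < \<theta>" "0 < m" "real (Suc m) * \<theta> < pi"
  shows "0 < branch_ratio \<theta> m"
proof -
  have "real m * \<theta> < pi"
    using assms by (simp add: distrib_right)
  then show ?thesis
    using assms by (simp add: branch_ratio_def sin_gt_zero del: of_nat_Suc)
qed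

text \<open>This is \<open>sin (x - \<theta>) + sin (x + \<theta>) = 2 * cos \<theta> * sin
  x\<close> divided by \<open>sin x\<close>, for \<open>x = (m + 1) * \<theta>\<close>. It survives
  \<open>sin ((m + 2) * \<theta>) = 0\<close>, where both divisions by 0 yield 0; the root of the
  tree is this case.\<close>

lemma branch_ratio_recurrence:
  assumes "sin (real (Suc m) * \<theta>) \<noteq> 0"
  shows "branch_ratio \<theta> m + 1 / branch_ratio \<theta> (Suc m) = 2 * cos \<theta>"
proof -
  have "sin (real m * \<theta>) + sin (real (Suc (Suc m)) * \<theta>)
      = sin (real (Suc m) * \<theta> - \<theta>) + sin (real (Suc m) * \<theta> + \<theta>)"
    by (simp add: algebra_simps)
  also have "\<dots> = 2 * cos \<theta> * sin (real (Suc m) * \<theta>)"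
    unfolding sin_add sin_diff by simp
  finally have "sin (real m * \<theta>) + sin (real (Suc (Suc m)) * \<theta>) = 2 * cos \<theta> * sin (real (Suc m) * \<theta>)" .
  then show ?thesis
    using assms by (simp add: branch_ratio_def field_simps del: of_nat_Suc)
qed

text \<open>For \<open>x = a * \<theta>\<close>, \<open>y = b * \<theta>\<close>,
  \<open>t = \<theta>\<close> the left side is the numerator of the subadditivity defect of
  \<open>branch_ratio\<close> over the common denominator. As a product its sign can be read
  off.\<close>

lemma sin_branch_identity:
  fixes x y t :: real
  shows "sin x * sin (y + t) * sin (x + y + t) + sin y * sin (x + t) * sin (x + y + t)
      - sin (x + y) * sin (x + t) * sin (y + t) = sin x * sin y * sin (x + y + 2 * t)"
proof -
  have "sin (x + t) * sin (y + t) = (sin x * cos t + cos x * sin t) * (sin y * cos t + cos y * sin t)"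
    by (simp add: sin_add)
  also have "\<dots> = sin x * sin y * ((sin t)\<^sup>2 + (cos t)\<^sup>2) + sin t * sin (x + y + t)"
    unfolding sin_add cos_add power2_eq_square by (simp add: algebra_simps del: sin_cos_squared_add3)
  finally have 1: "sin (x + t) * sin (y + t) = sin x * sin y + sin t * sin (x + y + t)"
    by simp
  have 2: "sin x * sin (y + t) + sin y * sin (x + t) = 2 * sin x * sin y * cos t + sin t * sin (x + y)"
    unfolding sin_add by (simp add: algebra_simps)
  have "sin (x + y + t + t) + sin (x + y + t - t) = 2 * sin (x + y + t) * cos t"
    unfolding sin_add[of _ t] sin_diff[of _ t] by simp
  then have 3: "sin (x + y + 2 * t) = 2 * sin (x + y + t) * cos t - sin (x + y)"
    by (simp add: add.assoc)
  have "sin x * sin (y + t) * sin (x + y + t) + sin y * sin (x + t) * sin (x + y + t)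
      - sin (x + y) * sin (x + t) * sin (y + t)
      = (sin x * sin (y + t) + sin y * sin (x + t)) * sin (x + y + t)
        - sin (x + y) * (sin (x + t) * sin (y + t))"
    by (simp add: algebra_simps)
  also have "\<dots> = sin x * sin y * sin (x + y + 2 * t)"
    unfolding 1 2 3 by (simp add: algebra_simps)
  finally show ?thesis .
qed

lemma branch_ratio_add:
  assumes "sin (real (Suc a) * \<theta>) \<noteq> 0" "sin (real (Suc b) * \<theta>) \<noteq> 0"
    "sin (real (Suc (a + b)) * \<theta>) \<noteq> 0"
  shows "branch_ratio \<theta> a + branch_ratio \<theta> b - branch_ratio \<theta> (a + b)
    = sin (real a * \<theta>) * sin (real b * \<theta>) * sin (real (a + b + 2) * \<theta>) /
      (sin (real (Suc a) * \<theta>) * sin (real (Suc b) * \<theta>) * sin (real (Suc (a + b)) * \<theta>))"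
proof -
  have e: "real (Suc a) * \<theta> = real a * \<theta> + \<theta>" "real (Suc b) * \<theta> = real b * \<theta> + \<theta>"
    "real (Suc (a + b)) * \<theta> = real a * \<theta> + real b * \<theta> + \<theta>"
    "real (a + b + 2) * \<theta> = real a * \<theta> + real b * \<theta> + 2 * \<theta>"
    "real (a + b) * \<theta> = real a * \<theta> + real b * \<theta>"
    by (simp_all add: algebra_simps)
  show ?thesis
    using assms unfolding branch_ratio_def e sin_branch_identity[symmetric]
    by (simp add: field_simps)
qed

text \<open>In the product formula for the defect all sines but
  \<open>sin ((a + b + 2) * \<theta>)\<close> have arguments in \<open>[0, pi)\<close>. The
  exceptional one vanishes when the bound \<open>pi\<close> is attained, so the strict version has
  to stay below it.\<close>

lemma
  assumes "0 < \<theta>" "real (a + b + 2) * \<theta> \<le> pi"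
  shows branch_ratio_subadd: "branch_ratio \<theta> (a + b) \<le> branch_ratio \<theta> a + branch_ratio \<theta> b"
    and branch_ratio_subadd_strict: "\<lbrakk>0 < a; 0 < b; real (a + b + 2) * \<theta> < pi\<rbrakk>
      \<Longrightarrow> branch_ratio \<theta> (a + b) < branch_ratio \<theta> a + branch_ratio \<theta> b"
proof -
  have lt: "real k * \<theta> < pi" if "k < a + b + 2" for k
  proof -
    have "real k * \<theta> < real (a + b + 2) * \<theta>"
      using that assms(1) by (intro mult_strict_right_mono) auto
    then show ?thesis using assms(2) by linarith
  qed
  have pos: "0 < sin (real k * \<theta>)" if "0 < k" "k < a + b + 2" for k
    using that assms(1) lt by (intro sin_gt_zero) auto
  have nn: "0 \<le> sin (real k * \<theta>)" if "k < a + b + 2" for k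
    using that assms(1) lt[of k] by (intro sin_ge_zero) auto
  have top: "0 \<le> sin (real (a + b + 2) * \<theta>)"
    using assms by (intro sin_ge_zero) auto
  have d: "0 < sin (real (Suc a) * \<theta>)" "0 < sin (real (Suc b) * \<theta>)"
    "0 < sin (real (Suc (a + b)) * \<theta>)"
    by (rule pos; simp)+
  have eq: "branch_ratio \<theta> a + branch_ratio \<theta> b - branch_ratio \<theta> (a + b)
    = sin (real a * \<theta>) * sin (real b * \<theta>) * sin (real (a + b + 2) * \<theta>) /
      (sin (real (Suc a) * \<theta>) * sin (real (Suc b) * \<theta>) * sin (real (Suc (a + b)) * \<theta>))"
    using d by (intro branch_ratio_add) auto
  have "0 \<le> branch_ratio \<theta> a + branch_ratio \<theta> b - branch_ratio \<theta> (a + b)"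
    unfolding eq using d nn[of a] nn[of b] top by (intro divide_nonneg_pos mult_nonneg_nonneg mult_pos_pos) auto
  then show "branch_ratio \<theta> (a + b) \<le> branch_ratio \<theta> a + branch_ratio \<theta> b" by simp
  assume s: "0 < a" "0 < b" "real (a + b + 2) * \<theta> < pi"
  have "0 < sin (real (a + b + 2) * \<theta>)"
    using s assms(1) by (intro sin_gt_zero) auto
  then have "0 < branch_ratio \<theta> a + branch_ratio \<theta> b - branch_ratio \<theta> (a + b)"
    unfolding eq using d pos[of a] pos[of b] s by (intro divide_pos_pos mult_pos_pos) auto
  then show "branch_ratio \<theta> (a + b) < branch_ratio \<theta> a + branch_ratio \<theta> b" by simp
qed

lemma branch_ratio_sum:
  assumes "finite I" "0 < \<theta>" "real ((\<Sum>i\<in>I. m i) + 2) * \<theta> \<le> pi"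
  shows "branch_ratio \<theta> (\<Sum>i\<in>I. m i) \<le> (\<Sum>i\<in>I. branch_ratio \<theta> (m i))"
  using assms(1,3)
proof (induction I rule: finite_induct)
  case (insert i I)
  have "real ((\<Sum>i\<in>I. m i) + 2) * \<theta> \<le> real ((\<Sum>i\<in>insert i I. m i) + 2) * \<theta>"
    using insert(1,2) assms(2) by (intro mult_right_mono) auto
  then have "branch_ratio \<theta> (\<Sum>i\<in>I. m i) \<le> (\<Sum>i\<in>I. branch_ratio \<theta> (m i))"
    using insert by linarith
  moreover have "branch_ratio \<theta> (m i + (\<Sum>i\<in>I. m i)) \<le> branch_ratio \<theta> (m i) + branch_ratio \<theta> (\<Sum>i\<in>I. m i)"
    using insert assms(2) by (intro branch_ratio_subadd) auto
  ultimately show ?case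
    using insert by simp
qed simp

text \<open>Strictness comes from separating a single index from the others taken together; the weak
  bound is enough for splitting up the others.\<close>

lemma branch_ratio_sum_strict:
  assumes "finite I" "0 < \<theta>" "real ((\<Sum>i\<in>I. m i) + 2) * \<theta> < pi"
    and "2 \<le> card I" "\<And>i. i \<in> I \<Longrightarrow> 0 < m i"
  shows "branch_ratio \<theta> (\<Sum>i\<in>I. m i) < (\<Sum>i\<in>I. branch_ratio \<theta> (m i))"
proof -
  obtain i J where I: "I = insert i J" "i \<notin> J" "finite J"
    using assms(1,4) by (metis Zero_not_Suc card.empty card_Suc_eq finite_insert
        numeral_2_eq_2 ex_in_conv mk_disjoint_insert not_less_eq_eq zero_le)
  then obtain j where j: "j \<in> J"
    using assms(4) by fastforce
  have "0 < (\<Sum>i\<in>J. m i)"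
    using j I assms(5) by (intro sum_pos) auto
  then have "branch_ratio \<theta> (m i + (\<Sum>i\<in>J. m i)) < branch_ratio \<theta> (m i) + branch_ratio \<theta> (\<Sum>i\<in>J. m i)"
    using I assms by (intro branch_ratio_subadd_strict) auto
  moreover have "real ((\<Sum>i\<in>J. m i) + 2) * \<theta> \<le> real ((\<Sum>i\<in>I. m i) + 2) * \<theta>"
    using I assms(2) by (intro mult_right_mono) auto
  then have "branch_ratio \<theta> (\<Sum>i\<in>J. m i) \<le> (\<Sum>i\<in>J. branch_ratio \<theta> (m i))"
    using I(3) assms(2,3) by (intro branch_ratio_sum) linarith+
  ultimately show ?thesis
    using I by simp
qed

section \<open>Eigenvalues of symmetric matrices\<close>

text \<open>The quadratic form is maximized over the unit sphere. The maximizer puts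
  \<open>\<mu>\<close> into the spectrum, and maximality turns every test vector into a lower bound
  for \<open>\<mu>\<close>.\<close>

lemma symmetric_top_eigenvector:
  fixes M :: "'a \<Rightarrow> 'a \<Rightarrow> real"
  assumes V: "finite V" "V \<noteq> {}" and sym: "\<And>u v. \<lbrakk>u \<in> V; v \<in> V\<rbrakk> \<Longrightarrow> M u v = M v u"
  obtains \<mu> f where "\<exists>v\<in>V. f v \<noteq> 0" "\<And>u. u \<in> V \<Longrightarrow> (\<Sum>v\<in>V. M u v * f v) = \<mu> * f u"
    and "\<And>h. (\<Sum>u\<in>V. h u * (\<Sum>v\<in>V. M u v * h v)) \<le> \<mu> * (\<Sum>u\<in>V. (h u)\<^sup>2)"
proof -
  define q where "q h = (\<Sum>u\<in>V. h u * (\<Sum>v\<in>V. M u v * h v))" for h :: "'a \<Rightarrow> real"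
  define N where "N h = (\<Sum>u\<in>V. (h u)\<^sup>2)" for h :: "'a \<Rightarrow> real"
  \<comment> \<open>The functions live on the whole type. Pinning them to 0 off \<open>V\<close>
    makes the box a product of compact sets, hence compact.\<close>
  define B where "B = PiE UNIV (\<lambda>u. if u \<in> V then {-1..1::real} else {0})"
  define S where "S = B \<inter> {h. N h = 1}"
  have "compactin (product_topology (\<lambda>_. euclidean) UNIV) B"
    unfolding B_def by (subst compactin_PiE) auto
  then have "compact B"
    by (simp add: euclidean_product_topology)
  have contN: "continuous_on UNIV N" and contq: "continuous_on UNIV q"
    unfolding N_def q_def by (intro continuous_intros continuous_on_product_coordinates)+
  have "closed {h. N h = 1}"
    by (intro closed_Collect_eq contN continuous_intros)
  with \<open>compact B\<close> have "compact S"
    unfolding S_def by (rule compact_Int_closed)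
  obtain w where w: "w \<in> V" using V by blast
  have "(\<lambda>u. if u = w then 1 else 0) \<in> S"
  proof -
    have "(\<lambda>u. if u = w then 1 else 0) \<in> B"
      using w by (auto simp: B_def PiE_iff)
    moreover have "N (\<lambda>u. if u = w then 1 else 0) = 1"
      using w V by (simp add: N_def if_distrib[of "\<lambda>x. x\<^sup>2"] cong: if_cong)
    ultimately show ?thesis by (simp add: S_def)
  qed
  then have "S \<noteq> {}" by blast
  from continuous_attains_sup[OF \<open>compact S\<close> this continuous_on_subset[OF contq subset_UNIV]]
  obtain f where f: "f \<in> S" and fmax: "\<And>h. h \<in> S \<Longrightarrow> q h \<le> q f" by blast
  define \<mu> where "\<mu> = q f"
  have Nf: "N f = 1" using f by (simp add: S_def)
  have le: "q h \<le> \<mu> * N h" for h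
  proof (cases "N h = 0")
    case True
    then have "\<forall>u\<in>V. h u = 0"
      unfolding N_def using V(1) by (simp add: sum_nonneg_eq_0_iff)
    then show ?thesis using True by (simp add: q_def)
  next
    case False
    have "0 \<le> N h" unfolding N_def by (intro sum_nonneg) auto
    with False have pos: "0 < N h" by simp
    define c where "c = sqrt (N h)"
    have c: "0 < c" "c\<^sup>2 = N h" using pos by (simp_all add: c_def)
    define k where "k u = (if u \<in> V then h u / c else 0)" for u
    have "N k = (\<Sum>u\<in>V. (h u)\<^sup>2 / c\<^sup>2)"
      unfolding N_def by (intro sum.cong) (auto simp: k_def power_divide)
    also have "\<dots> = N h / c\<^sup>2" by (simp add: N_def sum_divide_distrib)
    finally have Nk: "N k = 1" using c pos by simp
    have "k \<in> S"
    proof -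
      have "\<bar>k u\<bar> \<le> 1" if "u \<in> V" for u
      proof -
        have "(k u)\<^sup>2 \<le> N k"
          unfolding N_def using that V(1) by (intro member_le_sum) auto
        then show ?thesis using Nk by (simp add: abs_square_le_1)
      qed
      moreover have "k u = 0" if "u \<notin> V" for u
        using that by (simp add: k_def)
      ultimately have "k \<in> B" by (auto simp: B_def abs_le_iff minus_le_iff)
      then show ?thesis using Nk by (simp add: S_def)
    qed
    have "q k = (\<Sum>u\<in>V. (h u / c) * (\<Sum>v\<in>V. M u v * (h v / c)))"
      unfolding q_def by (intro sum.cong arg_cong2[of _ _ _ _ "(*)"]) (auto simp: k_def)
    also have "\<dots> = (\<Sum>u\<in>V. (h u * (\<Sum>v\<in>V. M u v * h v)) / c\<^sup>2)"
      by (intro sum.cong refl) (simp add: power2_eq_square flip: sum_divide_distrib)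
    also have "\<dots> = q h / c\<^sup>2"
      by (simp add: q_def sum_divide_distrib)
    finally have "q k = q h / c\<^sup>2" .
    with fmax[OF \<open>k \<in> S\<close>] c pos show ?thesis
      by (simp add: \<mu>_def field_simps)
  qed
  have eig: "(\<Sum>v\<in>V. M u v * f v) = \<mu> * f u" if u: "u \<in> V" for u
  proof -
    \<comment> \<open>first-order condition at the maximizer, in the direction of the residual\<close>
    define d where "d u = (\<Sum>v\<in>V. M u v * f v) - \<mu> * f u" for u
    define h where "h t v = f v + t * d v" for t v
    have symd: "(\<Sum>u\<in>V. f u * (\<Sum>v\<in>V. M u v * d v)) = (\<Sum>u\<in>V. d u * (\<Sum>v\<in>V. M u v * f v))"
    proof -
      have "(\<Sum>u\<in>V. f u * (\<Sum>v\<in>V. M u v * d v)) = (\<Sum>u\<in>V. \<Sum>v\<in>V. f u * M u v * d v)"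
        by (simp add: sum_distrib_left mult.assoc)
      also have "\<dots> = (\<Sum>v\<in>V. \<Sum>u\<in>V. f u * M u v * d v)"
        by (rule sum.swap)
      also have "\<dots> = (\<Sum>v\<in>V. d v * (\<Sum>u\<in>V. M v u * f u))"
        unfolding sum_distrib_left by (intro sum.cong refl) (simp add: sym mult_ac)
      finally show ?thesis .
    qed
    have qh: "q (h t) = q f + 2 * t * (\<Sum>u\<in>V. d u * (\<Sum>v\<in>V. M u v * f v)) + t\<^sup>2 * q d" for t
    proof -
      have "q (h t) = (\<Sum>u\<in>V. f u * (\<Sum>v\<in>V. M u v * f v)) + t * (\<Sum>u\<in>V. f u * (\<Sum>v\<in>V. M u v * d v))
        + t * (\<Sum>u\<in>V. d u * (\<Sum>v\<in>V. M u v * f v)) + t\<^sup>2 * (\<Sum>u\<in>V. d u * (\<Sum>v\<in>V. M u v * d v))"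
        unfolding q_def h_def sum_distrib_left[of t] sum_distrib_left[of "t\<^sup>2"] sum.distrib[symmetric]
      proof (intro sum.cong refl)
        fix u
        have "(\<Sum>v\<in>V. M u v * (f v + t * d v)) = (\<Sum>v\<in>V. M u v * f v) + t * (\<Sum>v\<in>V. M u v * d v)"
          by (simp add: distrib_left sum.distrib sum_distrib_left mult_ac)
        then show "(f u + t * d u) * (\<Sum>v\<in>V. M u v * (f v + t * d v)) =
         f u * (\<Sum>v\<in>V. M u v * f v) + t * (f u * (\<Sum>v\<in>V. M u v * d v)) +
         t * (d u * (\<Sum>v\<in>V. M u v * f v)) + t\<^sup>2 * (d u * (\<Sum>v\<in>V. M u v * d v))"
          by (simp add: algebra_simps power2_eq_square)
      qed
      then show ?thesis unfolding symd by (simp add: q_def)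
    qed
    have Nh: "N (h t) = N f + 2 * t * (\<Sum>u\<in>V. d u * f u) + t\<^sup>2 * N d" for t
      unfolding N_def h_def sum_distrib_left sum.distrib[symmetric]
      by (intro sum.cong refl) (simp add: algebra_simps power2_eq_square)
    have Nd: "(\<Sum>u\<in>V. d u * (\<Sum>v\<in>V. M u v * f v)) - \<mu> * (\<Sum>u\<in>V. d u * f u) = N d"
      unfolding N_def sum_distrib_left[of \<mu>] sum_subtractf[symmetric]
    proof (intro sum.cong refl)
      fix u
      have "(\<Sum>v\<in>V. M u v * f v) = d u + \<mu> * f u" by (simp add: d_def)
      then show "d u * (\<Sum>v\<in>V. M u v * f v) - \<mu> * (d u * f u) = (d u)\<^sup>2"
        by (simp add: power2_eq_square algebra_simps)
    qed
    \<comment> \<open>Along \<open>f + t * d\<close> the bound by \<open>\<mu>\<close> is an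
      equality at \<open>t = 0\<close>, so its linear term \<open>2 * t * N d\<close> has to be
      absorbed by the quadratic one.\<close>
    have key: "2 * t * N d \<le> t\<^sup>2 * (\<mu> * N d - q d)" for t
    proof -
      have "q f + 2 * t * (\<Sum>u\<in>V. d u * (\<Sum>v\<in>V. M u v * f v)) + t\<^sup>2 * q d
        \<le> \<mu> * (N f + 2 * t * (\<Sum>u\<in>V. d u * f u) + t\<^sup>2 * N d)"
        using le[of "h t"] unfolding qh Nh .
      moreover have "(\<Sum>u\<in>V. d u * (\<Sum>v\<in>V. M u v * f v)) = \<mu> * (\<Sum>u\<in>V. d u * f u) + N d"
        using Nd by simp
      ultimately show ?thesis
        by (simp only: \<mu>_def[symmetric] Nf) (simp add: algebra_simps)
    qed
    have "N d \<le> 0"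
    proof (rule ccontr)
      assume "\<not> N d \<le> 0"
      then have p: "0 < N d" by simp
      define c where "c = \<bar>\<mu> * N d - q d\<bar> + 1"
      have c: "0 < c" "\<mu> * N d - q d \<le> c" by (auto simp: c_def)
      \<comment> \<open>With this step the quadratic term is at most \<open>t * N d\<close>, half of
        the linear term.\<close>
      define t where "t = N d / c"
      have t: "0 < t" using p c by (simp add: t_def)
      have "2 * t * N d \<le> t\<^sup>2 * c"
        using key[of t] mult_left_mono[OF c(2), of "t\<^sup>2"] by simp
      also have "\<dots> = t * N d" using c by (simp add: t_def power2_eq_square)
      finally show False using t p by (simp add: mult_pos_pos)
    qed
    moreover have "(d u)\<^sup>2 \<le> N d"
      unfolding N_def using u V(1) by (intro member_le_sum) auto
    ultimately have "(d u)\<^sup>2 \<le> 0" by linarith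
    then have "d u = 0" by simp
    then show ?thesis by (simp add: d_def)
  qed
  have "\<exists>v\<in>V. f v \<noteq> 0"
  proof (rule ccontr)
    assume "\<not> (\<exists>v\<in>V. f v \<noteq> 0)"
    then show False using Nf by (simp add: N_def)
  qed
  then show ?thesis
    using that[of f \<mu>] eig le by (simp add: q_def N_def)
qed

text \<open>At a vertex \<open>w\<close> where \<open>\<bar>f u\<bar> / g u\<close> is largest,
  \<open>\<bar>f\<bar>\<close> touches a multiple of \<open>g\<close> that dominates it everywhere;
  the row of \<open>w\<close> then compares \<open>x\<close> with \<open>\<mu>\<close>. In
  particular a positive eigenvector belongs to the largest eigenvalue.\<close>

lemma eigenvalue_le_of_positive_supersolution:
  fixes M :: "'a \<Rightarrow> 'a \<Rightarrow> real"
  assumes V: "finite V" and M: "\<And>u v. \<lbrakk>u \<in> V; v \<in> V\<rbrakk> \<Longrightarrow> 0 \<le> M u v"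
    and g: "\<And>u. u \<in> V \<Longrightarrow> 0 < g u" "\<And>u. u \<in> V \<Longrightarrow> (\<Sum>v\<in>V. M u v * g v) \<le> \<mu> * g u"
    and f: "\<exists>v\<in>V. f v \<noteq> 0" "\<And>u. u \<in> V \<Longrightarrow> (\<Sum>v\<in>V. M u v * f v) = x * f u"
  shows "x \<le> \<mu>"
proof -
  define r where "r u = \<bar>f u\<bar> / g u" for u
  obtain w where w: "w \<in> V" "\<And>u. u \<in> V \<Longrightarrow> r u \<le> r w"
  proof -
    have "Max (r ` V) \<in> r ` V" using V f(1) by (intro Max_in) auto
    then obtain w where "w \<in> V" "Max (r ` V) = r w" by auto
    then show ?thesis using that V by (metis Max_ge finite_imageI imageI)
  qed
  have fr: "\<bar>f u\<bar> = r u * g u" if "u \<in> V" for u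
    using g(1)[OF that] by (simp add: r_def)
  obtain v where v: "v \<in> V" "f v \<noteq> 0" using f(1) by blast
  then have "0 < r v" using g(1) by (simp add: r_def)
  then have rw: "0 < r w" using w(2)[OF v(1)] by simp
  have "x * \<bar>f w\<bar> \<le> \<bar>x * f w\<bar>" by (simp add: abs_mult mult_right_mono)
  also have "\<dots> = \<bar>\<Sum>v\<in>V. M w v * f v\<bar>" using f(2)[OF w(1)] by simp
  also have "\<dots> \<le> (\<Sum>v\<in>V. M w v * \<bar>f v\<bar>)"
    using M w(1) by (intro order_trans[OF sum_abs] sum_mono) (simp add: abs_mult)
  also have "\<dots> \<le> (\<Sum>v\<in>V. M w v * (r w * g v))"
    using M w g(1) by (intro sum_mono mult_left_mono) (auto simp: fr less_imp_le intro!: mult_right_mono)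
  also have "\<dots> = r w * (\<Sum>v\<in>V. M w v * g v)"
    by (simp add: sum_distrib_left mult_ac)
  also have "\<dots> \<le> r w * (\<mu> * g w)"
    using g(2)[OF w(1)] rw by (intro mult_left_mono) auto
  also have "\<dots> = \<mu> * \<bar>f w\<bar>" using fr[OF w(1)] by simp
  finally have "x * \<bar>f w\<bar> \<le> \<mu> * \<bar>f w\<bar>" .
  moreover have "0 < \<bar>f w\<bar>" using fr[OF w(1)] rw g(1)[OF w(1)] by simp
  ultimately show ?thesis by simp
qed

section \<open>Trees\<close>

text \<open>Trees in a form suited to growing vertex sets: connectedness is an edge across every
  cut, and a cycle is a repetition-free list whose ends are adjacent. Length 3 keeps an edge
  traversed back and forth from counting as a cycle.\<close>

locale acyclic_connected =
  fixes V :: "'a set" and E :: "'a rel"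
  assumes finite_V: "finite V" and E_sub: "E \<subseteq> V \<times> V"
    and E_sym: "(u, v) \<in> E \<Longrightarrow> (v, u) \<in> E" and E_irrefl: "(u, u) \<notin> E"
    and crossing_edge: "\<lbrakk>S \<subseteq> V; S \<noteq> {}; S \<noteq> V\<rbrakk> \<Longrightarrow> \<exists>u\<in>S. \<exists>w\<in>V - S. (u, w) \<in> E"
    and no_cycle: "\<lbrakk>distinct xs; 3 \<le> length xs; successively (\<lambda>u v. (u, v) \<in> E) xs\<rbrakk>
      \<Longrightarrow> (last xs, hd xs) \<notin> E"
begin

lemma no_triangle: "\<lbrakk>(u, v) \<in> E; (v, w) \<in> E\<rbrakk> \<Longrightarrow> (w, u) \<notin> E"
  using no_cycle[of "[u, v, w]"] E_irrefl by auto

lemma no_square: "\<lbrakk>(u, v) \<in> E; (v, w) \<in> E; (w, x) \<in> E; u \<noteq> w; v \<noteq> x\<rbrakk> \<Longrightarrow> (x, u) \<notin> E"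
  using no_cycle[of "[u, v, w, x]"] E_irrefl by auto

definition edge_path :: "'a list \<Rightarrow> bool" where
  "edge_path xs \<longleftrightarrow> xs \<noteq> [] \<and> distinct xs \<and> set xs \<subseteq> V \<and> successively (\<lambda>u v. (u, v) \<in> E) xs"

text \<open>The path must stay inside \<open>S\<close>, the vertices enumerated so far, so that a
  vertex outside \<open>S\<close> can close it to a cycle.\<close>

definition joins :: "'a \<Rightarrow> 'a \<Rightarrow> 'a set \<Rightarrow> bool" where
  "joins a b S \<longleftrightarrow> (\<exists>ys. edge_path ys \<and> set ys \<subseteq> S \<and> hd ys = a \<and> last ys = b)"

text \<open>The enumeration grows along cut edges. A new vertex \<open>w\<close> has only one
  neighbour among the old ones: two would be joined by a path of old vertices, which
  \<open>w\<close> would close to a cycle. That neighbour serves as parent.\<close>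

lemma search_order:
  assumes r: "r \<in> V"
  obtains vs where "distinct vs" "set vs = V" "vs ! 0 = r"
    and "\<And>i. \<lbrakk>0 < i; i < card V\<rbrakk> \<Longrightarrow> \<exists>!j. j < i \<and> (vs ! j, vs ! i) \<in> E"
proof -
  have "\<exists>vs. length vs = Suc k \<and> distinct vs \<and> set vs \<subseteq> V \<and> vs ! 0 = r \<and>
      (\<forall>i. 0 < i \<and> i < Suc k \<longrightarrow> (\<exists>!j. j < i \<and> (vs ! j, vs ! i) \<in> E)) \<and>
      (\<forall>a\<in>set vs. \<forall>b\<in>set vs. joins a b (set vs))" if "Suc k \<le> card V" for k
    using that
  proof (induction k)
    case 0
    have "joins r r {r}"
      unfolding joins_def using r by (intro exI[of _ "[r]"]) (simp add: edge_path_def)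
    then show ?case using r by (intro exI[of _ "[r]"]) simp
  next
    case (Suc k)
    then obtain vs where vs: "length vs = Suc k" "distinct vs" "set vs \<subseteq> V" "vs ! 0 = r"
      and par: "\<And>i. 0 < i \<and> i < Suc k \<Longrightarrow> \<exists>!j. j < i \<and> (vs ! j, vs ! i) \<in> E"
      and conn: "\<And>a b. \<lbrakk>a \<in> set vs; b \<in> set vs\<rbrakk> \<Longrightarrow> joins a b (set vs)"
      by auto
    have "card (set vs) = Suc k" using vs by (simp add: distinct_card)
    then have "set vs \<noteq> V" "set vs \<noteq> {}" using Suc.prems by auto
    then obtain u w where uw: "u \<in> set vs" "w \<in> V" "w \<notin> set vs" "(u, w) \<in> E"
      using crossing_edge[OF vs(3)] by blast
    have wu: "(w, u) \<in> E" using uw(4) by (rule E_sym)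
    have uniq: "x = u" if x: "x \<in> set vs" "(x, w) \<in> E" for x
    proof (rule ccontr)
      assume "x \<noteq> u"
      obtain ys where ys: "edge_path ys" "set ys \<subseteq> set vs" "hd ys = u" "last ys = x"
        using conn[OF uw(1) x(1)] unfolding joins_def by blast
      then have "2 \<le> length ys"
        using \<open>x \<noteq> u\<close> by (cases ys; cases "tl ys") (auto simp: edge_path_def)
      moreover have "successively (\<lambda>u v. (u, v) \<in> E) (w # ys)"
        using ys uw wu by (auto simp: edge_path_def successively_Cons)
      ultimately have "(last (w # ys), hd (w # ys)) \<notin> E"
        using ys uw by (intro no_cycle) (auto simp: edge_path_def)
      then show False using ys x by (simp add: edge_path_def)
    qed
    have "\<exists>!j. j < i \<and> ((vs @ [w]) ! j, (vs @ [w]) ! i) \<in> E" if i: "0 < i" "i < Suc (Suc k)" for i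
    proof (cases "i = Suc k")
      case True
      obtain j where j: "j < Suc k" "vs ! j = u" using uw(1) vs(1) by (metis in_set_conv_nth)
      show ?thesis
      proof (rule ex1I[of _ j])
        show "j < i \<and> ((vs @ [w]) ! j, (vs @ [w]) ! i) \<in> E"
          using j True vs uw by (simp add: nth_append)
        fix l assume "l < i \<and> ((vs @ [w]) ! l, (vs @ [w]) ! i) \<in> E"
        then have l: "l < Suc k" "(vs ! l, w) \<in> E" using True vs by (auto simp: nth_append)
        then have "vs ! l = u" using vs by (intro uniq) auto
        then show "l = j" using j l vs nth_eq_iff_index_eq[of vs l j] by simp
      qed
    next
      case False
      then have i': "i < Suc k" using i by simp
      have "(j < i \<and> ((vs @ [w]) ! j, (vs @ [w]) ! i) \<in> E) = (j < i \<and> (vs ! j, vs ! i) \<in> E)" for j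
        using i' vs by (auto simp: nth_append)
      then show ?thesis using par[of i] i i' by simp
    qed
    moreover have "joins a b (set (vs @ [w]))" if ab: "a \<in> set (vs @ [w])" "b \<in> set (vs @ [w])" for a b
    proof -
      consider "a = w" "b = w" | "a \<in> set vs" "b \<in> set vs" | "a = w" "b \<in> set vs" | "a \<in> set vs" "b = w"
        using ab by auto
      then show ?thesis
      proof cases
        case 1
        then show ?thesis
          unfolding joins_def using uw by (intro exI[of _ "[w]"]) (simp add: edge_path_def)
      next
        case 2
        then show ?thesis using conn[of a b] unfolding joins_def by fastforce
      next
        case 3
        obtain ys where "edge_path ys" "set ys \<subseteq> set vs" "hd ys = u" "last ys = b"
          using conn[OF uw(1) 3(2)] unfolding joins_def by blast
        then show ?thesis
          unfolding joins_def using uw wu 3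
          by (intro exI[of _ "w # ys"]) (auto simp: edge_path_def successively_Cons)
      next
        case 4
        obtain ys where "edge_path ys" "set ys \<subseteq> set vs" "hd ys = a" "last ys = u"
          using conn[OF 4(1) uw(1)] unfolding joins_def by blast
        then show ?thesis
          unfolding joins_def using uw 4
          by (intro exI[of _ "ys @ [w]"]) (auto simp: edge_path_def successively_append_iff)
      qed
    qed
    ultimately show ?case
      using vs uw by (intro exI[of _ "vs @ [w]"]) (simp add: nth_append)
  qed
  moreover have "0 < card V" using r finite_V by (auto simp: card_gt_0_iff)
  then have "Suc (card V - 1) = card V" by simp
  ultimately obtain vs where
    vs: "length vs = card V" "distinct vs" "set vs \<subseteq> V" "vs ! 0 = r"
      "\<And>i. 0 < i \<and> i < card V \<Longrightarrow> \<exists>!j. j < i \<and> (vs ! j, vs ! i) \<in> E"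
    by (metis order_refl)
  then have "set vs = V"
    by (intro card_subset_eq finite_V) (auto simp: distinct_card)
  then show ?thesis using that[of vs] vs by blast
qed

text \<open>Take a longest path. If it misses a vertex, some edge leaves it, and not from an end, as
  the path could then be extended; an inner vertex with a third neighbour results. If it covers
  \<open>V\<close>, any further edge would close one of its segments to a cycle.\<close>

lemma path_or_branch_vertex:
  assumes "V \<noteq> {}"
  obtains (path) \<phi> where "bij_betw \<phi> {0..<card V} V"
      "\<And>i j. \<lbrakk>i < card V; j < card V\<rbrakk> \<Longrightarrow> (\<phi> i, \<phi> j) \<in> E \<longleftrightarrow> j = Suc i \<or> i = Suc j"
    | (branch) c x y z where "(c, x) \<in> E" "(c, y) \<in> E" "(c, z) \<in> E" "x \<noteq> y" "x \<noteq> z" "y \<noteq> z"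
proof -
  let ?E = "\<lambda>u v. (u, v) \<in> E"
  obtain r where r: "r \<in> V" using assms by blast
  then have "edge_path [r]" by (simp add: edge_path_def)
  moreover have "length xs < Suc (card V)" if "edge_path xs" for xs
    using that card_mono[OF finite_V, of "set xs"] by (auto simp: edge_path_def distinct_card)
  ultimately obtain xs where xs: "edge_path xs" and mx: "\<And>ys. edge_path ys \<Longrightarrow> length ys \<le> length xs"
    using ex_has_greatest_nat[of edge_path "[r]" length "Suc (card V)"] by blast
  have ne: "xs \<noteq> []" and d: "distinct xs" and sub: "set xs \<subseteq> V" and suc: "successively ?E xs"
    using xs by (auto simp: edge_path_def)
  have step: "(xs ! i, xs ! Suc i) \<in> E" if "Suc i < length xs" for i
    using suc that by (simp add: successively_conv_nth)
  show ?thesis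
  proof (cases "set xs = V")
    case False
    then obtain u w where uw: "u \<in> set xs" "w \<in> V" "w \<notin> set xs" "(u, w) \<in> E"
      using crossing_edge[OF sub] ne by auto
    have wu: "(w, u) \<in> E" using uw(4) by (rule E_sym)
    obtain i where i: "i < length xs" "xs ! i = u" using uw(1) by (metis in_set_conv_nth)
    have "i \<noteq> 0"
    proof
      assume "i = 0"
      then have "edge_path (w # xs)"
        using i uw wu ne d sub suc by (auto simp: edge_path_def successively_Cons hd_conv_nth)
      then show False using mx by fastforce
    qed
    moreover have "Suc i < length xs"
    proof (rule ccontr)
      assume "\<not> Suc i < length xs"
      then have "last xs = u" using i ne by (metis Suc_lessI diff_Suc_1 last_conv_nth)
      then have "edge_path (xs @ [w])"
        using uw ne d sub suc by (auto simp: edge_path_def successively_append_iff)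
      then show False using mx by fastforce
    qed
    ultimately obtain j where j: "i = Suc j" "Suc (Suc j) < length xs" by (cases i) auto
    have "(u, xs ! j) \<in> E" "(u, xs ! Suc i) \<in> E"
      using step[of j] step[of i] j i E_sym[of "xs ! j"] by auto
    moreover have "xs ! j \<noteq> xs ! Suc i" using d j by (simp add: nth_eq_iff_index_eq)
    moreover have "xs ! j \<noteq> w" "xs ! Suc i \<noteq> w" using uw j by auto
    ultimately show ?thesis using branch[of u "xs ! j" "xs ! Suc i" w] uw by blast
  next
    case True
    have len: "length xs = card V" using True d by (metis distinct_card)
    have chord: "(xs ! i, xs ! j) \<notin> E" if "Suc i < j" "j < length xs" for i j
    proof -
      define ys where "ys = take (Suc j - i) (drop i xs)"
      have l: "length ys = Suc j - i" using that by (simp add: ys_def)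
      have nth: "ys ! k = xs ! (i + k)" if "k < Suc j - i" for k
        using that \<open>j < length xs\<close> by (simp add: ys_def)
      have "ys \<noteq> []" using l that by auto
      then have "hd ys = xs ! i" "last ys = xs ! j"
        using nth[of 0] nth[of "j - i"] l that by (auto simp: hd_conv_nth last_conv_nth)
      moreover have "distinct ys" using d by (simp add: ys_def)
      moreover have "successively ?E ys"
        unfolding successively_conv_nth using l nth step that by auto
      ultimately have "(xs ! j, xs ! i) \<notin> E" using no_cycle[of ys] l that by auto
      then show ?thesis using E_sym by blast
    qed
    have "(xs ! i, xs ! j) \<in> E \<longleftrightarrow> j = Suc i \<or> i = Suc j" if "i < card V" "j < card V" for i j
    proof
      assume e: "(xs ! i, xs ! j) \<in> E"
      then have "(xs ! j, xs ! i) \<in> E" by (rule E_sym)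
      then have "\<not> Suc i < j" "\<not> Suc j < i"
        using e chord[of i j] chord[of j i] that len by auto
      moreover have "i \<noteq> j" using e E_irrefl by auto
      ultimately show "j = Suc i \<or> i = Suc j" by linarith
    next
      assume "j = Suc i \<or> i = Suc j"
      then show "(xs ! i, xs ! j) \<in> E"
        using step[of i] step[of j] E_sym[of "xs ! j" "xs ! i"] that len by auto
    qed
    moreover have "bij_betw ((!) xs) {0..<card V} V"
      by (rule bij_betw_nth[OF d]) (simp_all add: True len lessThan_atLeast0)
    ultimately show ?thesis using path[of "(!) xs"] by blast
  qed
qed

end

section \<open>The test vector\<close>

text \<open>Parents are numbered before their children. The bound \<open>i < j\<close> keeps 0,
  where \<open>p\<close> is arbitrary, from being a child, and lets recursion over children
  terminate.\<close>

definition children :: "(nat \<Rightarrow> nat) \<Rightarrow> nat \<Rightarrow> nat \<Rightarrow> nat set" where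
  "children p n i = {j. i < j \<and> j < n \<and> p j = i}"

lemma finite_children [simp]: "finite (children p n i)"
  by (simp add: children_def)

function subtree_size :: "(nat \<Rightarrow> nat) \<Rightarrow> nat \<Rightarrow> nat \<Rightarrow> nat" where
  "subtree_size p n i = Suc (\<Sum>j\<in>children p n i. subtree_size p n j)"
  by auto
termination
  by (relation "Wellfounded.measure (\<lambda>(p, n, i). n - i)") (auto simp: children_def)

declare subtree_size.simps [simp del]

text \<open>The guard gives termination for arbitrary \<open>p\<close>. It fails at 0, so the root
  has value 1.\<close>

function down_product :: "(nat \<Rightarrow> real) \<Rightarrow> (nat \<Rightarrow> nat) \<Rightarrow> nat \<Rightarrow> real" where
  "down_product s p i = (if p i < i then s i * down_product s p (p i) else 1)"
  by auto
termination
  by (relation "Wellfounded.measure (\<lambda>(s, p, i). i)") auto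

declare down_product.simps [simp del]

context
  fixes p :: "nat \<Rightarrow> nat" and n :: nat
  assumes parent: "\<And>i. \<lbrakk>0 < i; i < n\<rbrakk> \<Longrightarrow> p i < i"
begin

text \<open>The vertices from \<open>k\<close> on whose parent lies before \<open>k\<close> are the
  roots of disjoint subtrees that make up \<open>{k..<n}\<close>. Lowering the threshold to
  \<open>k\<close> puts \<open>k\<close> in place of its children, whose sizes add up to one less
  than its own.\<close>

lemma sum_subtree_size_frontier:
  assumes "1 \<le> k" "k \<le> n"
  shows "(\<Sum>j | k \<le> j \<and> j < n \<and> p j < k. subtree_size p n j) = n - k"
  using assms(2,1)
proof (induction k rule: inc_induct)
  case base
  then show ?case by simp
next
  case (step k)
  let ?F = "\<lambda>k. {j. k \<le> j \<and> j < n \<and> p j < k}"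
  have F: "?F k = insert k (?F (Suc k) - children p n k)" "k \<notin> ?F (Suc k) - children p n k"
    using step parent[of k] by (auto simp: children_def Suc_le_eq less_Suc_eq le_less)
  have sub: "children p n k \<subseteq> ?F (Suc k)"
    by (auto simp: children_def)
  have fin: "finite (?F (Suc k))" by simp
  have "(\<Sum>j\<in>?F (Suc k) - children p n k. subtree_size p n j) + (\<Sum>j\<in>children p n k. subtree_size p n j)
      = (\<Sum>j\<in>?F (Suc k). subtree_size p n j)"
    using sum.subset_diff[OF sub fin, of "subtree_size p n"] by simp
  also have "\<dots> = n - Suc k" using step by simp
  finally have "(\<Sum>j\<in>?F k. subtree_size p n j) = Suc (n - Suc k)"
    unfolding F(1) using F(2) fin by (simp add: subtree_size.simps[of p n k])
  then show ?case using step by simp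
qed

lemma subtree_size_root: "1 \<le> n \<Longrightarrow> subtree_size p n 0 = n"
proof -
  assume n: "1 \<le> n"
  have "children p n 0 = {j. 1 \<le> j \<and> j < n \<and> p j < 1}"
    by (auto simp: children_def)
  then show ?thesis
    using sum_subtree_size_frontier[of 1] n by (simp add: subtree_size.simps[of p n 0])
qed

lemma subtree_size_less: "\<lbrakk>0 < i; i < n\<rbrakk> \<Longrightarrow> subtree_size p n i < n"
proof -
  assume i: "0 < i" "i < n"
  have "subtree_size p n i \<le> (\<Sum>j | i \<le> j \<and> j < n \<and> p j < i. subtree_size p n j)"
    using i parent by (intro member_le_sum) auto
  also have "\<dots> = n - i" using i by (intro sum_subtree_size_frontier) auto
  finally show ?thesis using i by simp
qed

text \<open>
  The ratio of the test vector at a vertex to its value at the parent is what it would be on a path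
  with as many vertices below.
\<close>

lemma tree_test_vector:
  assumes n: "2 \<le> n" and \<theta>: "\<theta> = pi / real (Suc n)"
  obtains g where "\<And>i. i < n \<Longrightarrow> 0 < g i"
    and "\<And>i. i < n \<Longrightarrow> 2 * cos \<theta> * g i \<le> (\<Sum>j\<in>children p n i. g j) + (if i = 0 then 0 else g (p i))"
    and "\<And>i. \<lbrakk>0 < i; i < n; 2 \<le> card (children p n i)\<rbrakk>
      \<Longrightarrow> 2 * cos \<theta> * g i < (\<Sum>j\<in>children p n i. g j) + g (p i)"
proof -
  define m where "m = subtree_size p n"
  define s where "s i = branch_ratio \<theta> (m i)" for i
  define g where "g = down_product s p"
  have \<theta>0: "0 < \<theta>" by (simp add: \<theta>)
  have \<theta>n: "real (Suc n) * \<theta> = pi" by (simp add: \<theta> del: of_nat_Suc)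
  have small: "real k * \<theta> < pi" if "k \<le> n" for k
  proof -
    have "real k * \<theta> < real (Suc n) * \<theta>"
      using that \<theta>0 by (intro mult_strict_right_mono) auto
    then show ?thesis using \<theta>n by simp
  qed
  have m: "m i = Suc (\<Sum>j\<in>children p n i. m j)" for i
    unfolding m_def by (rule subtree_size.simps)
  have ml: "m i < n" if "0 < i" "i < n" for i
    using subtree_size_less[OF that] by (simp add: m_def)
  have spos: "0 < s i" if "0 < i" "i < n" for i
    unfolding s_def using ml[OF that] m[of i] \<theta>0 by (intro branch_ratio_pos small) auto
  have g0: "g 0 = 1" unfolding g_def by (subst down_product.simps) simp
  have g: "g i = s i * g (p i)" if "0 < i" "i < n" for i
    unfolding g_def using parent[OF that] by (subst down_product.simps) simp
  have gpos: "0 < g i" if "i < n" for i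
    using that
  proof (induction i rule: less_induct)
    case (less i)
    show ?case
    proof (cases "i = 0")
      case False
      then have "p i < i" using parent less.prems by simp
      then show ?thesis
        using less False g[of i] spos[of i] by (simp add: mult_pos_pos)
    qed (simp add: g0)
  qed
  have sum_g: "(\<Sum>j\<in>children p n i. g j) = (\<Sum>j\<in>children p n i. s j) * g i" for i
    unfolding sum_distrib_right by (intro sum.cong refl) (auto simp: children_def g)
  have sum_m: "(\<Sum>j\<in>children p n i. m j) = m i - 1" for i
    using m[of i] by simp
  \<comment> \<open>Since \<open>g (p i) = g i / s i\<close>, the parent accounts for the term
    \<open>1 / s i\<close> of the recurrence, and the children have to supply the other one.\<close>
  have up: "2 * cos \<theta> * g i = (branch_ratio \<theta> (m i - 1)) * g i + g (p i)" if i: "0 < i" "i < n" for i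
  proof -
    have "0 < m i" by (subst m) simp
    then have "0 < sin (real (m i) * \<theta>)"
      using ml[OF i] \<theta>0 small[of "m i"] by (intro sin_gt_zero) auto
    then have "branch_ratio \<theta> (m i - 1) + 1 / s i = 2 * cos \<theta>"
      using branch_ratio_recurrence[of "m i - 1" \<theta>] \<open>0 < m i\<close> by (simp add: s_def)
    then have "2 * cos \<theta> * g i = (branch_ratio \<theta> (m i - 1) + 1 / s i) * g i"
      by simp
    also have "\<dots> = branch_ratio \<theta> (m i - 1) * g i + g i / s i"
      by (simp add: distrib_right)
    finally have "2 * cos \<theta> * g i = branch_ratio \<theta> (m i - 1) * g i + g i / s i" .
    then show ?thesis using g[OF i] spos[OF i] by simp
  qed
  \<comment> \<open>Here \<open>(n + 1) * \<theta> = pi\<close>, so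
    \<open>branch_ratio \<theta> n\<close> has denominator \<open>sin pi = 0\<close> and the
    reciprocal term disappears: the root gets along without a parent.\<close>
  have root: "branch_ratio \<theta> (n - 1) = 2 * cos \<theta>"
  proof -
    have "0 < sin (real n * \<theta>)"
      using n \<theta>0 small[of n] by (intro sin_gt_zero) auto
    moreover have "branch_ratio \<theta> n = sin (real n * \<theta>) / sin pi"
      using \<theta>n by (simp add: branch_ratio_def)
    ultimately show ?thesis
      using branch_ratio_recurrence[of "n - 1" \<theta>] n by simp
  qed
  have "2 * cos \<theta> * g i \<le> (\<Sum>j\<in>children p n i. g j) + (if i = 0 then 0 else g (p i))" if i: "i < n" for i
  proof -
    have mn: "m i \<le> n" using ml[of i] i subtree_size_root n by (cases "i = 0") (auto simp: m_def)
    have "branch_ratio \<theta> (\<Sum>j\<in>children p n i. m j) \<le> (\<Sum>j\<in>children p n i. s j)"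
      unfolding s_def
    proof (rule branch_ratio_sum[OF _ \<theta>0])
      have "real ((\<Sum>j\<in>children p n i. m j) + 2) \<le> real (Suc n)"
        using sum_m[of i] mn m[of i] by linarith
      then have "real ((\<Sum>j\<in>children p n i. m j) + 2) * \<theta> \<le> real (Suc n) * \<theta>"
        using \<theta>0 by (intro mult_right_mono) auto
      then show "real ((\<Sum>j\<in>children p n i. m j) + 2) * \<theta> \<le> pi"
        unfolding \<theta>n .
    qed simp
    then have "branch_ratio \<theta> (m i - 1) * g i \<le> (\<Sum>j\<in>children p n i. g j)"
      unfolding sum_g sum_m using gpos[OF i] by (intro mult_right_mono) auto
    then show ?thesis
      using up[of i] i root subtree_size_root n by (cases "i = 0") (auto simp: m_def)
  qed
  moreover have "2 * cos \<theta> * g i < (\<Sum>j\<in>children p n i. g j) + g (p i)"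
    if i: "0 < i" "i < n" "2 \<le> card (children p n i)" for i
  proof -
    have "branch_ratio \<theta> (\<Sum>j\<in>children p n i. m j) < (\<Sum>j\<in>children p n i. s j)"
      unfolding s_def
    proof (rule branch_ratio_sum_strict[OF _ \<theta>0])
      \<comment> \<open>The sum plus 2 is \<open>m i + 1\<close>, which is at most \<open>n\<close>
        away from the root. At the root it is \<open>n + 1\<close>, and \<open>pi\<close> would be
        attained.\<close>
      show "real ((\<Sum>j\<in>children p n i. m j) + 2) * \<theta> < pi"
        using sum_m[of i] ml[of i] i m[of i] by (intro small) linarith
      show "0 < m j" for j using m[of j] by simp
    qed (use i in auto)
    then have "branch_ratio \<theta> (m i - 1) * g i < (\<Sum>j\<in>children p n i. g j)"
      unfolding sum_g sum_m using gpos[OF i(2)] by (intro mult_strict_right_mono) auto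
    then show ?thesis using up[of i] i by simp
  qed
  ultimately show ?thesis using that[of g] gpos by blast
qed

end

text \<open>Rooting at the neighbour \<open>x\<close> makes \<open>c\<close> a non-root vertex. Only
  one of its neighbours is its parent, so at least two are children, and the test vector is strict
  at \<open>c\<close>. Summing over children and parent is summing over all neighbours, because
  every non-root vertex has a unique earlier neighbour.\<close>

lemma (in acyclic_connected) branch_vertex_test_vector:
  assumes c: "(c, x) \<in> E" "(c, y) \<in> E" "(c, z) \<in> E" "x \<noteq> y" "x \<noteq> z" "y \<noteq> z"
    and \<theta>: "\<theta> = pi / real (Suc (card V))"
  obtains f where "\<And>u. u \<in> V \<Longrightarrow> 0 < f u"
    and "\<And>u. u \<in> V \<Longrightarrow> 2 * cos \<theta> * f u \<le> (\<Sum>v | (u, v) \<in> E. f v)"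
    and "2 * cos \<theta> * f c < (\<Sum>v | (c, v) \<in> E. f v)"
proof -
  define n where "n = card V"
  have V: "c \<in> V" "x \<in> V" using c E_sub by auto
  have "c \<noteq> x" using c E_irrefl by auto
  then have n: "2 \<le> n"
    using V card_mono[OF finite_V, of "{c, x}"] by (simp add: n_def)
  obtain vs where vs: "distinct vs" "set vs = V" "vs ! 0 = x"
    and ord: "\<And>i. \<lbrakk>0 < i; i < card V\<rbrakk> \<Longrightarrow> \<exists>!j. j < i \<and> (vs ! j, vs ! i) \<in> E"
    using search_order[OF V(2)] by metis
  have len: "length vs = n" using vs by (metis distinct_card n_def)
  have mem: "vs ! i \<in> V" if "i < n" for i using that len vs(2) by (metis nth_mem)
  have inj: "inj_on ((!) vs) {..<n}" using vs(1) len by (simp add: inj_on_nth)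
  define p where "p i = (THE j. j < i \<and> (vs ! j, vs ! i) \<in> E)" for i
  have p: "p i < i" "(vs ! p i, vs ! i) \<in> E" if "0 < i" "i < n" for i
    using theI'[OF ord[of i]] that by (auto simp: p_def n_def)
  have p_eq: "p i = j" if "i < n" "j < i" "(vs ! j, vs ! i) \<in> E" for i j
    using ord[of i] p[of i] that unfolding n_def by (metis gr_implies_not0 neq0_conv)
  obtain g where g: "\<And>i. i < n \<Longrightarrow> 0 < g i"
    and ge: "\<And>i. i < n \<Longrightarrow> 2 * cos \<theta> * g i \<le> (\<Sum>j\<in>children p n i. g j) + (if i = 0 then 0 else g (p i))"
    and gt: "\<And>i. \<lbrakk>0 < i; i < n; 2 \<le> card (children p n i)\<rbrakk>
      \<Longrightarrow> 2 * cos \<theta> * g i < (\<Sum>j\<in>children p n i. g j) + g (p i)"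
    using tree_test_vector[OF p(1) n \<theta>[folded n_def]] by blast
  define f where "f v = g (the_inv_into {..<n} ((!) vs) v)" for v
  have f: "f (vs ! i) = g i" if "i < n" for i
    using that inj by (simp add: f_def the_inv_into_f_f)
  let ?N = "\<lambda>i. children p n i \<union> (if i = 0 then {} else {p i})"
  have N: "{v. (vs ! i, v) \<in> E} = (!) vs ` ?N i" if i: "i < n" for i
  proof (intro equalityI subsetI)
    fix v assume "v \<in> {v. (vs ! i, v) \<in> E}"
    then have e: "(vs ! i, v) \<in> E" "(v, vs ! i) \<in> E" using E_sym by auto
    then have "v \<in> V" using E_sub by auto
    then obtain j where j: "j < n" "v = vs ! j" using vs(2) len by (metis in_set_conv_nth)
    have "i \<noteq> j" using e j E_irrefl by auto
    then consider "i < j" | "j < i" by linarith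
    then have "j \<in> ?N i"
      using p_eq[of j i] p_eq[of i j] i j e by cases (auto simp: children_def)
    then show "v \<in> (!) vs ` ?N i" using j by simp
  next
    fix v assume "v \<in> (!) vs ` ?N i"
    then obtain j where j: "j \<in> ?N i" "v = vs ! j" by blast
    then consider "0 < i" "j = p i" | "i < j" "j < n" "p j = i"
      by (auto simp: children_def split: if_splits)
    then have "(vs ! i, vs ! j) \<in> E"
      using p[of i] p[of j] i E_sym[of "vs ! j" "vs ! i"] by cases auto
    then show "v \<in> {v. (vs ! i, v) \<in> E}" using j by simp
  qed
  have Nsub: "?N i \<subseteq> {..<n}" if "i < n" for i
    using that p(1)[of i] by (auto simp: children_def)
  have pc: "p i \<notin> children p n i" if "0 < i" "i < n" for i
    using p(1)[OF that] by (auto simp: children_def)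
  have sumN: "(\<Sum>v | (vs ! i, v) \<in> E. f v) = (\<Sum>j\<in>children p n i. g j) + (if i = 0 then 0 else g (p i))"
    if i: "i < n" for i
  proof -
    have "(\<Sum>v | (vs ! i, v) \<in> E. f v) = (\<Sum>j\<in>?N i. f (vs ! j))"
      unfolding N[OF i] using inj_on_subset[OF inj Nsub[OF i]] by (simp add: sum.reindex)
    also have "\<dots> = (\<Sum>j\<in>?N i. g j)"
      using Nsub[OF i] by (intro sum.cong refl f) auto
    finally show ?thesis using pc[of i] i by (auto simp: add.commute)
  qed
  show ?thesis
  proof (rule that)
    fix u assume "u \<in> V"
    then obtain i where i: "i < n" "u = vs ! i" using vs(2) len by (metis in_set_conv_nth)
    show "0 < f u" using g f i by simp
    show "2 * cos \<theta> * f u \<le> (\<Sum>v | (u, v) \<in> E. f v)"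
      using ge[OF i(1)] sumN[OF i(1)] f[OF i(1)] i(2) by simp
  next
    obtain i where i: "i < n" "c = vs ! i" using vs(2) len V by (metis in_set_conv_nth)
    have i0: "0 < i" using i vs(3) \<open>c \<noteq> x\<close> by (metis neq0_conv)
    have "3 = card {x, y, z}" using c by simp
    also have "\<dots> \<le> card {v. (c, v) \<in> E}"
      using c by (intro card_mono finite_subset[OF _ finite_V, of "{v. (c, v) \<in> E}"]) (use E_sub in auto)
    also have "\<dots> \<le> card (?N i)"
      unfolding i(2) N[OF i(1)] by (intro card_image_le) simp
    also have "\<dots> \<le> Suc (card (children p n i))"
      using i0 by (simp add: card_insert_if)
    finally have "2 \<le> card (children p n i)" by simp
    then show "2 * cos \<theta> * f c < (\<Sum>v | (c, v) \<in> E. f v)"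
      using gt[OF i0 i(1)] sumN[OF i(1)] f[OF i(1)] i0 i(2) by simp
  qed
qed

section \<open>Distances in complements\<close>

lemma graph_dist_eqI:
  assumes "pair_wf_digraph G" "pre_digraph.awalk (with_proj G) u ps v" "length ps = k"
    and min: "\<And>qs. pre_digraph.awalk (with_proj G) u qs v \<Longrightarrow> k \<le> length qs"
  shows "graph_dist G u v = real k"
proof -
  interpret pair_wf_digraph G by fact
  have cost: "awalk_cost (\<lambda>_. 1) qs = real (length qs)" for qs :: "('a \<times> 'a) list"
    by (induction qs) auto
  have "\<mu> (\<lambda>_. 1) u v = ereal (real k)"
    unfolding \<mu>_def
  proof (rule antisym)
    show "(INF qs\<in>{qs. awalk u qs v}. ereal (awalk_cost (\<lambda>_. 1) qs)) \<le> ereal (real k)"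
      using assms(2,3) by (intro INF_lower2[of ps]) (auto simp: cost)
    show "ereal (real k) \<le> (INF qs\<in>{qs. awalk u qs v}. ereal (awalk_cost (\<lambda>_. 1) qs))"
      using min by (intro INF_greatest) (auto simp: cost)
  qed
  then show ?thesis by (simp add: graph_dist_def)
qed

lemma awalk_pair_iff:
  "pre_digraph.awalk (with_proj G) u ps v \<longleftrightarrow> u \<in> pverts G \<and> set ps \<subseteq> parcs G \<and> pcas u ps v"
  by (simp add: pre_digraph.awalk_def cas_with_proj_eq)

lemma list_cases_upto_2:
  obtains "ps = []" | a where "ps = [a]" | a b where "ps = [a, b]" | "3 \<le> length ps"
  by (cases ps; cases "tl ps"; cases "tl (tl ps)") auto

lemma graph_dist_cases:
  assumes "pair_wf_digraph G" and u: "u \<in> pverts G"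
  shows graph_dist_refl: "graph_dist G u u = 0"
    and graph_dist_1: "\<lbrakk>u \<noteq> v; (u, v) \<in> parcs G\<rbrakk> \<Longrightarrow> graph_dist G u v = 1"
    and graph_dist_2: "\<lbrakk>u \<noteq> v; (u, v) \<notin> parcs G; (u, w) \<in> parcs G; (w, v) \<in> parcs G\<rbrakk>
      \<Longrightarrow> graph_dist G u v = 2"
    and graph_dist_3: "\<lbrakk>u \<noteq> v; (u, v) \<notin> parcs G; \<And>w. (u, w) \<in> parcs G \<Longrightarrow> (w, v) \<notin> parcs G;
      (u, x) \<in> parcs G; (x, y) \<in> parcs G; (y, v) \<in> parcs G\<rbrakk> \<Longrightarrow> graph_dist G u v = 3"
proof -
  show "graph_dist G u u = 0"
    using graph_dist_eqI[OF assms(1), of u "[]" u 0] u by (simp add: awalk_pair_iff)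
  show "graph_dist G u v = 1" if "u \<noteq> v" "(u, v) \<in> parcs G"
  proof -
    have "1 \<le> length qs" if "pcas u qs v" for qs
      using that \<open>u \<noteq> v\<close> by (cases qs) auto
    then show ?thesis
      using graph_dist_eqI[OF assms(1), of u "[(u, v)]" v 1] u that by (simp add: awalk_pair_iff)
  qed
  show "graph_dist G u v = 2" if "u \<noteq> v" "(u, v) \<notin> parcs G" "(u, w) \<in> parcs G" "(w, v) \<in> parcs G"
  proof -
    have "2 \<le> length qs" if "pcas u qs v" "set qs \<subseteq> parcs G" for qs
      using that \<open>u \<noteq> v\<close> \<open>(u, v) \<notin> parcs G\<close> by (cases qs rule: list_cases_upto_2) auto
    then show ?thesis
      using graph_dist_eqI[OF assms(1), of u "[(u, w), (w, v)]" v 2] u that by (simp add: awalk_pair_iff)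
  qed
  show "graph_dist G u v = 3" if "u \<noteq> v" "(u, v) \<notin> parcs G" "\<And>w. (u, w) \<in> parcs G \<Longrightarrow> (w, v) \<notin> parcs G"
      "(u, x) \<in> parcs G" "(x, y) \<in> parcs G" "(y, v) \<in> parcs G"
  proof -
    have "3 \<le> length qs" if "pcas u qs v" "set qs \<subseteq> parcs G" for qs
      using that \<open>u \<noteq> v\<close> \<open>(u, v) \<notin> parcs G\<close> \<open>\<And>w. (u, w) \<in> parcs G \<Longrightarrow> (w, v) \<notin> parcs G\<close>
      by (cases qs rule: list_cases_upto_2) auto
    then show ?thesis
      using graph_dist_eqI[OF assms(1), of u "[(u, x), (x, y), (y, v)]" v 3] u that
      by (simp add: awalk_pair_iff)
  qed
qed

text \<open>
  The distance in the complement, for graphs without dominating vertices and 4-cycles: then the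
  endpoints of an edge \<open>uv\<close> without common non-neighbour have non-neighbours \<open>x\<close> and \<open>y\<close>, and
  \<open>u, x, y, v\<close> is a walk in the complement.
\<close>

definition codist :: "'a set \<Rightarrow> 'a rel \<Rightarrow> 'a \<Rightarrow> 'a \<Rightarrow> real" where
  "codist V E u v = (if u = v then 0 else if (u, v) \<notin> E then 1
     else if \<exists>w\<in>V. w \<noteq> u \<and> w \<noteq> v \<and> (u, w) \<notin> E \<and> (v, w) \<notin> E then 2 else 3)"

lemma pair_wf_digraph_complement: "pair_wf_digraph (graph_complement G)"
  by unfold_locales (auto simp: graph_complement_def)

text \<open>These properties are shared by the given tree and by the path graph, for which they are
  checked directly, without proving it to be a tree. For a tree, \<open>no_dominating\<close>
  expresses that it is not a star.\<close>

locale square_free_graph =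
  fixes V :: "'a set" and E :: "'a rel"
  assumes finite_V: "finite V" and E_sub: "E \<subseteq> V \<times> V"
    and E_sym: "(u, v) \<in> E \<Longrightarrow> (v, u) \<in> E" and E_irrefl: "(u, u) \<notin> E"
    and no_dominating: "u \<in> V \<Longrightarrow> \<exists>w\<in>V. w \<noteq> u \<and> (u, w) \<notin> E"
    and no_square: "\<lbrakk>(u, v) \<in> E; (v, w) \<in> E; (w, x) \<in> E; u \<noteq> w; v \<noteq> x\<rbrakk> \<Longrightarrow> (x, u) \<notin> E"

lemma graph_dist_complement:
  assumes G: "square_free_graph (pverts G) (parcs G)" and uv: "u \<in> pverts G" "v \<in> pverts G"
  shows "graph_dist (graph_complement G) u v = codist (pverts G) (parcs G) u v"
proof -
  note E = square_free_graph.E_sym[OF G] square_free_graph.E_irrefl[OF G]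
  note dom = square_free_graph.no_dominating[OF G] and square = square_free_graph.no_square[OF G]
  let ?C = "graph_complement G"
  have C: "(a, b) \<in> parcs ?C \<longleftrightarrow> a \<in> pverts G \<and> b \<in> pverts G \<and> a \<noteq> b \<and> (a, b) \<notin> parcs G" for a b
    by (simp add: graph_complement_def)
  have u: "u \<in> pverts ?C" using uv by (simp add: graph_complement_def)
  note dist = graph_dist_cases[OF pair_wf_digraph_complement u]
  consider (refl) "u = v" | (one) "u \<noteq> v" "(u, v) \<notin> parcs G"
    | (two) w where "u \<noteq> v" "(u, v) \<in> parcs G" "w \<in> pverts G" "w \<noteq> u" "w \<noteq> v" "(u, w) \<notin> parcs G" "(v, w) \<notin> parcs G"
    | (three) "u \<noteq> v" "(u, v) \<in> parcs G"
        "\<not> (\<exists>w\<in>pverts G. w \<noteq> u \<and> w \<noteq> v \<and> (u, w) \<notin> parcs G \<and> (v, w) \<notin> parcs G)"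
    by blast
  then show ?thesis
  proof cases
    case refl
    then show ?thesis using dist(1) by (simp add: codist_def)
  next
    case one
    then show ?thesis using dist(2)[of v] uv by (simp add: codist_def C)
  next
    case (two w)
    have "(w, v) \<notin> parcs G" using two(7) E(1) by blast
    then have "graph_dist ?C u v = 2" using dist(3)[of v w] two uv by (simp add: C)
    moreover have "codist (pverts G) (parcs G) u v = 2" using two unfolding codist_def by auto
    ultimately show ?thesis by simp
  next
    case three
    have vu: "(v, u) \<in> parcs G" using three(2) by (rule E(1))
    obtain x where x: "x \<in> pverts G" "x \<noteq> u" "(u, x) \<notin> parcs G" using dom uv by blast
    obtain y where y: "y \<in> pverts G" "y \<noteq> v" "(v, y) \<notin> parcs G" using dom uv by blast
    have xv: "x \<noteq> v" "y \<noteq> u" using x y three vu by auto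
    have vx: "(v, x) \<in> parcs G" and uy: "(u, y) \<in> parcs G" using three(3) x y xv by blast+
    have yu: "(y, u) \<in> parcs G" using uy by (rule E(1))
    have xy: "x \<noteq> y" using x uy by auto
    \<comment> \<open>Otherwise \<open>y, u, v, x\<close> would be a 4-cycle.\<close>
    have nxy: "(x, y) \<notin> parcs G" using square[OF yu three(2) vx] y(2) x(2) by blast
    have yv: "(y, v) \<notin> parcs G" using y E(1) by blast
    have "(w, v) \<notin> parcs ?C" if "(u, w) \<in> parcs ?C" for w
    proof
      assume "(w, v) \<in> parcs ?C"
      then have "w \<noteq> v" "(v, w) \<notin> parcs G" using E(1) by (auto simp: C)
      then show False using three(3) that unfolding C by metis
    qed
    then have "graph_dist ?C u v = 3"
      using three uv x y xv xy nxy yv by (intro dist(4)[of v x y]) (auto simp: C)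
    then show ?thesis using three by (simp add: codist_def)
  qed
qed

section \<open>Undirected trees and isomorphisms\<close>

lemma vwalk_arcs_pair:
  assumes "p \<noteq> []"
  shows pcas_vwalk_arcs: "pcas (hd p) (vwalk_arcs p) (last p)"
    and pawalk_verts_vwalk_arcs: "pawalk_verts (hd p) (vwalk_arcs p) = p"
    and set_vwalk_arcs_subset_iff: "set (vwalk_arcs p) \<subseteq> E \<longleftrightarrow> successively (\<lambda>u v. (u, v) \<in> E) p"
    and length_vwalk_arcs: "length (vwalk_arcs p) = length p - 1"
  using assms by (induction p rule: vwalk_arcs.induct) auto

lemma acyclic_connected_undirected_tree:
  assumes "undirected_tree T"
  shows "acyclic_connected (pverts T) (parcs T)"
proof -
  interpret pair_graph T using assms by (simp add: undirected_tree_def)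
  have conn: "strongly_connected (with_proj (mk_symmetric (with_proj T)))"
    using assms by (simp add: undirected_tree_def connected_def)
  have sym: "sym (parcs T)" using sym_arcs by (simp add: symmetric_def)
  show ?thesis
  proof
    show "finite (pverts T)" by (rule pair_finite_verts)
    show "parcs T \<subseteq> pverts T \<times> pverts T" by (auto dest: in_arcsD1 in_arcsD2)
    show "(v, u) \<in> parcs T" if "(u, v) \<in> parcs T" for u v using sym that by (rule symD)
    show "(u, u) \<notin> parcs T" for u using pair_no_loops by fastforce
  next
    fix S assume S: "S \<subseteq> pverts T" "S \<noteq> {}" "S \<noteq> pverts T"
    then obtain a b where ab: "a \<in> S" "b \<in> pverts T" "b \<notin> S" by blast
    \<comment> \<open>Connectedness is defined through the symmetric closure, which adds no arcs
      here. A walk from \<open>a\<close> in \<open>S\<close> to \<open>b\<close> outside then has an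
      arc that leaves \<open>S\<close>.\<close>
    have "parcs (mk_symmetric (with_proj T)) = parcs T"
      using sym by (auto simp: parcs_mk_symmetric dest: symD)
    then have "(a, b) \<in> rtrancl_on (pverts T) (parcs T)"
      using conn ab S unfolding strongly_connected_def reachable_def by auto
    then show "\<exists>u\<in>S. \<exists>w\<in>pverts T - S. (u, w) \<in> parcs T"
      using ab by (induction rule: rtrancl_on_induct) blast+
  next
    fix xs assume xs: "distinct xs" "3 \<le> length xs" "successively (\<lambda>u v. (u, v) \<in> parcs T) xs"
    show "(last xs, hd xs) \<notin> parcs T"
    proof
      assume e: "(last xs, hd xs) \<in> parcs T"
      have ne: "xs \<noteq> []" using xs by auto
      define ys where "ys = xs @ [hd xs]"
      have ys: "ys \<noteq> []" "hd ys = hd xs" "last ys = hd xs" using ne by (auto simp: ys_def)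
      have "successively (\<lambda>u v. (u, v) \<in> parcs T) ys"
        using xs e by (simp add: ys_def successively_append_iff)
      then have "set (vwalk_arcs ys) \<subseteq> parcs T"
        using set_vwalk_arcs_subset_iff[OF ys(1)] by blast
      moreover have "hd xs \<in> pverts T" using e in_arcsD2 by blast
      ultimately have "pre_digraph.awalk (with_proj T) (hd xs) (vwalk_arcs ys) (hd xs)"
        using pcas_vwalk_arcs[OF ys(1)] ys by (simp add: awalk_pair_iff)
      moreover have "distinct (tl (pawalk_verts (hd xs) (vwalk_arcs ys)))"
        using pawalk_verts_vwalk_arcs[OF ys(1)] ys xs(1) ne
        by (cases xs) (auto simp: ys_def)
      moreover have "3 \<le> length (vwalk_arcs ys)"
        using length_vwalk_arcs[OF ys(1)] xs(2) by (simp add: ys_def)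
      ultimately have "pre_digraph.cycle (with_proj T) (vwalk_arcs ys) \<and> 3 \<le> length (vwalk_arcs ys)"
        unfolding pre_digraph.cycle_def awalk_verts_with_proj_eq by force
      then show False using assms unfolding undirected_tree_def by blast
    qed
  qed
qed

text \<open>An edge avoiding a dominating vertex would form a triangle with it. So all edges would
  meet \<open>u\<close>, and the tree would be a star.\<close>

lemma no_dominating_vertex:
  assumes "acyclic_connected (pverts T) (parcs T)" "card (pverts T) = n"
    and "\<not> complete_bipartite_digraph 1 (n - 1) (with_proj T)" and u: "u \<in> pverts T"
  shows "\<exists>w\<in>pverts T. w \<noteq> u \<and> (u, w) \<notin> parcs T"
proof (rule ccontr)
  interpret acyclic_connected "pverts T" "parcs T" by fact
  assume "\<not> (\<exists>w\<in>pverts T. w \<noteq> u \<and> (u, w) \<notin> parcs T)"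
  then have dom: "(u, w) \<in> parcs T" "(w, u) \<in> parcs T" if "w \<in> pverts T" "w \<noteq> u" for w
    using that E_sym by blast+
  have star: "a = u \<or> b = u" if "(a, b) \<in> parcs T" for a b
    using no_triangle[OF dom(1) that] dom(2)[of b] that E_sub by blast
  have "parcs T = {u} \<times> (pverts T - {u}) \<union> (pverts T - {u}) \<times> {u}"
    using dom star E_irrefl E_sub by fast
  moreover have "card (pverts T - {u}) = n - 1" using u assms(2) finite_V by simp
  moreover have "pverts T = {u} \<union> (pverts T - {u})" "{u} \<inter> (pverts T - {u}) = {}" "card {u} = 1"
    using u by auto
  ultimately have "complete_bipartite_digraph 1 (n - 1) (with_proj T)"
    unfolding complete_bipartite_digraph_pair_def using finite_V by blast
  then show False using assms(3) by blast
qed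

text \<open>A library isomorphism brings its own arc map, tail and head. Between pair digraphs tail
  and head must be \<open>fst\<close> and \<open>snd\<close>, which forces the arc map to apply
  \<open>\<phi>\<close> to both components.\<close>

lemma digraph_iso_pair_iff:
  assumes G: "pair_wf_digraph G" and H: "pair_wf_digraph H"
  shows "digraph_iso (with_proj G) (with_proj H) \<longleftrightarrow>
    (\<exists>\<phi>. bij_betw \<phi> (pverts G) (pverts H) \<and>
      (\<forall>u\<in>pverts G. \<forall>v\<in>pverts G. (u, v) \<in> parcs G \<longleftrightarrow> (\<phi> u, \<phi> v) \<in> parcs H))"
proof
  interpret G: pair_wf_digraph G by fact
  assume "digraph_iso (with_proj G) (with_proj H)"
  then obtain h where h: "pre_digraph.digraph_isomorphism (with_proj G) h" "with_proj H = app_iso h (with_proj G)"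
    unfolding digraph_iso_def by blast
  define \<phi> where "\<phi> = iso_verts h"
  have inj: "inj_on \<phi> (pverts G)"
    and ends: "\<And>a. a \<in> parcs G \<Longrightarrow> \<phi> (fst a) = iso_tail h (iso_arcs h a) \<and> \<phi> (snd a) = iso_head h (iso_arcs h a)"
    using h(1) by (auto simp: pre_digraph.digraph_isomorphism_def \<phi>_def)
  have eqs: "pverts H = \<phi> ` pverts G" "parcs H = iso_arcs h ` parcs G" "iso_tail h = fst" "iso_head h = snd"
    using arg_cong[OF h(2), of verts] arg_cong[OF h(2), of arcs] arg_cong[OF h(2), of tail]
      arg_cong[OF h(2), of head] by (simp_all add: \<phi>_def)
  have arc: "iso_arcs h (u, v) = (\<phi> u, \<phi> v)" if "(u, v) \<in> parcs G" for u v
    using ends[OF that] by (simp add: eqs prod_eq_iff)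
  have "(u, v) \<in> parcs G" if uv: "u \<in> pverts G" "v \<in> pverts G" "(\<phi> u, \<phi> v) \<in> parcs H" for u v
  proof -
    obtain a b where ab: "(a, b) \<in> parcs G" "(\<phi> u, \<phi> v) = (\<phi> a, \<phi> b)"
      using uv(3) arc unfolding eqs(2) by fastforce
    then have "a \<in> pverts G" "b \<in> pverts G" using G.in_arcsD1 G.in_arcsD2 by blast+
    then have "a = u" "b = v" using ab(2) uv inj by (auto dest: inj_onD)
    then show ?thesis using ab(1) by simp
  qed
  moreover have "(\<phi> u, \<phi> v) \<in> parcs H" if "(u, v) \<in> parcs G" for u v
    using arc[OF that] that eqs(2) by (metis imageI)
  ultimately show "\<exists>\<phi>. bij_betw \<phi> (pverts G) (pverts H) \<and>
      (\<forall>u\<in>pverts G. \<forall>v\<in>pverts G. (u, v) \<in> parcs G \<longleftrightarrow> (\<phi> u, \<phi> v) \<in> parcs H)"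
    using inj eqs(1) by (intro exI[of _ \<phi>]) (auto simp: bij_betw_def)
next
  interpret G: pair_wf_digraph G by fact
  interpret H: pair_wf_digraph H by fact
  assume "\<exists>\<phi>. bij_betw \<phi> (pverts G) (pverts H) \<and>
      (\<forall>u\<in>pverts G. \<forall>v\<in>pverts G. (u, v) \<in> parcs G \<longleftrightarrow> (\<phi> u, \<phi> v) \<in> parcs H)"
  then obtain \<phi> where bij: "bij_betw \<phi> (pverts G) (pverts H)"
    and iff: "\<And>u v. \<lbrakk>u \<in> pverts G; v \<in> pverts G\<rbrakk> \<Longrightarrow> (u, v) \<in> parcs G \<longleftrightarrow> (\<phi> u, \<phi> v) \<in> parcs H"
    by blast
  have inj: "inj_on \<phi> (pverts G)" and im: "pverts H = \<phi> ` pverts G"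
    using bij by (auto simp: bij_betw_def)
  define h where "h = \<lparr>iso_verts = \<phi>, iso_arcs = map_prod \<phi> \<phi>, iso_head = snd, iso_tail = fst\<rparr>"
  have "parcs H = map_prod \<phi> \<phi> ` parcs G"
  proof (intro equalityI subsetI)
    fix a assume a: "a \<in> parcs H"
    then have "fst a \<in> \<phi> ` pverts G" "snd a \<in> \<phi> ` pverts G"
      using H.arc_fst_in_verts H.arc_snd_in_verts im by auto
    then obtain u v where uv: "u \<in> pverts G" "v \<in> pverts G" "a = (\<phi> u, \<phi> v)"
      by (cases a) auto
    then have "(u, v) \<in> parcs G" using iff a by simp
    then show "a \<in> map_prod \<phi> \<phi> ` parcs G" using uv(3) by force
  next
    fix a assume "a \<in> map_prod \<phi> \<phi> ` parcs G"
    then obtain u v where "(u, v) \<in> parcs G" "a = (\<phi> u, \<phi> v)" by auto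
    then show "a \<in> parcs H" using iff G.in_arcsD1 G.in_arcsD2 by blast
  qed
  then have "with_proj H = app_iso h (with_proj G)"
    using im by (simp add: app_iso_def h_def with_proj_def)
  moreover have "inj_on (map_prod \<phi> \<phi>) (parcs G)"
  proof (rule inj_onI)
    fix a b assume ab: "a \<in> parcs G" "b \<in> parcs G" "map_prod \<phi> \<phi> a = map_prod \<phi> \<phi> b"
    then have "\<phi> (fst a) = \<phi> (fst b)" "\<phi> (snd a) = \<phi> (snd b)"
      by (metis fst_map_prod snd_map_prod)+
    then show "a = b"
      using inj ab G.arc_fst_in_verts G.arc_snd_in_verts by (simp add: prod_eq_iff inj_on_eq_iff)
  qed
  then have "pre_digraph.digraph_isomorphism (with_proj G) h"
    using inj G.wf_digraph_axioms by (simp add: pre_digraph.digraph_isomorphism_def h_def)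
  ultimately show "digraph_iso (with_proj G) (with_proj H)"
    unfolding digraph_iso_def by blast
qed

section \<open>Eccentricity matrices of complements\<close>

definition codist_entry :: "'a set \<Rightarrow> 'a rel \<Rightarrow> 'a \<Rightarrow> 'a \<Rightarrow> real" where
  "codist_entry V E u v =
     (if codist V E u v = min (Max (codist V E u ` V)) (Max (codist V E v ` V))
      then codist V E u v else 0)"

lemma ecc_entry_complement:
  assumes "square_free_graph (pverts G) (parcs G)" "u \<in> pverts G" "v \<in> pverts G"
  shows "ecc_entry (graph_complement G) u v = codist_entry (pverts G) (parcs G) u v"
proof -
  have "eccentricity (graph_complement G) w = Max (codist (pverts G) (parcs G) w ` pverts G)"
    if "w \<in> pverts G" for w
    unfolding eccentricity_def using graph_dist_complement[OF assms(1) that]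
    by (intro arg_cong[of _ _ Max] image_cong) (simp_all add: graph_complement_def)
  then show ?thesis
    using assms by (simp add: ecc_entry_def codist_entry_def graph_dist_complement)
qed

lemma codist_nonneg: "0 \<le> codist V E u v"
  by (simp add: codist_def)

lemma codist_entry_nonneg: "0 \<le> codist_entry V E u v"
  unfolding codist_entry_def by (split if_split) (intro conjI impI codist_nonneg order_refl)

context square_free_graph
begin

lemma codist_sym: "codist V E u v = codist V E v u"
  using E_sym[of u v] E_sym[of v u] by (auto simp: codist_def)

lemma codist_entry_sym: "codist_entry V E u v = codist_entry V E v u"
  by (simp add: codist_entry_def codist_sym[of u v] min.commute)

lemma codist_le_Max: "v \<in> V \<Longrightarrow> codist V E u v \<le> Max (codist V E u ` V)"
  using finite_V by (intro Max_ge) auto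

end

text \<open>If the entry were 0, both ends would have vertices \<open>u'\<close> and
  \<open>v'\<close> at distance 3. Distance 3 means that every other vertex is adjacent to an end of
  the edge \<open>u u'\<close>. As \<open>v'\<close> is not adjacent to \<open>u\<close>, which
  would give a triangle, it is adjacent to \<open>u'\<close>, and \<open>u, v, v', u'\<close> is a
  4-cycle.\<close>

lemma codist_entry_edge_ge:
  assumes "acyclic_connected V E" "square_free_graph V E" and e: "(u, v) \<in> E"
  shows "2 \<le> codist_entry V E u v"
proof -
  interpret acyclic_connected V E by fact
  interpret square_free_graph V E by fact
  let ?e = "\<lambda>u. Max (codist V E u ` V)"
  have uv: "u \<in> V" "v \<in> V" "u \<noteq> v" "(v, u) \<in> E" using e E_sub E_irrefl E_sym by auto
  have ge: "2 \<le> codist V E u v" using e uv by (simp add: codist_def)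
  have le3: "codist V E a b \<le> 3" for a b by (simp add: codist_def)
  have "codist V E u v = min (?e u) (?e v)"
  proof (rule ccontr)
    assume "codist V E u v \<noteq> min (?e u) (?e v)"
    moreover have "codist V E u v \<le> ?e u" "codist V E u v \<le> ?e v"
      using codist_le_Max[of v u] codist_le_Max[of u v] uv by (simp_all add: codist_sym[of v u])
    ultimately have lt: "codist V E u v < ?e u" "codist V E u v < ?e v" by linarith+
    have attained: "\<exists>b\<in>V. ?e a = codist V E a b" if "a \<in> V" for a
    proof -
      have "?e a \<in> codist V E a ` V" using finite_V that by (intro Max_in) auto
      then show ?thesis by auto
    qed
    obtain u' where u': "u' \<in> V" "codist V E u v < codist V E u u'"
      using attained[OF uv(1)] lt by auto
    obtain v' where v': "v' \<in> V" "codist V E u v < codist V E v v'"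
      using attained[OF uv(2)] lt by auto
    have cover: "(a, b) \<in> E \<and> (\<forall>w\<in>V. w = a \<or> w = b \<or> (a, w) \<in> E \<or> (b, w) \<in> E)"
      if "2 < codist V E a b" for a b
      using that unfolding codist_def by (auto split: if_splits)
    have cu: "(u, u') \<in> E" "\<And>w. w \<in> V \<Longrightarrow> w = u \<or> w = u' \<or> (u, w) \<in> E \<or> (u', w) \<in> E"
      using cover[of u u'] u' ge by auto
    have cv: "(v, v') \<in> E" using cover[of v v'] v' ge by auto
    have "u' \<noteq> v" using u' by auto
    have "v' \<noteq> u" using v' by (auto simp: codist_sym[of v u])
    have "(u, v') \<notin> E" using no_triangle[OF e cv] E_sym by blast
    have "v' \<noteq> u'" using \<open>(u, v') \<notin> E\<close> cu(1) by blast
    then have "(v', u') \<in> E"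
      using cu(2)[OF v'(1)] \<open>v' \<noteq> u\<close> \<open>(u, v') \<notin> E\<close> E_sym by blast
    then have "(u', u) \<notin> E"
      using square_free_graph.no_square[OF assms(2) e cv] \<open>v' \<noteq> u\<close> \<open>u' \<noteq> v\<close> by blast
    then show False using cu(1) E_sym by blast
  qed
  then show ?thesis using ge unfolding codist_entry_def by simp
qed

section \<open>Spectra of complements and their invariance under isomorphism\<close>

lemma ecc_spectrum_iff:
  assumes "finite (pverts G)"
  shows "x \<in> ecc_spectrum G \<longleftrightarrow>
    (\<exists>f. (\<exists>v\<in>pverts G. f v \<noteq> 0) \<and>
         (\<forall>u\<in>pverts G. (\<Sum>v\<in>pverts G. ecc_entry G u v * f v) = x * f u))"
proof -
  obtain vs where "distinct vs" "set vs = pverts G"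
    using finite_distinct_list[OF assms] by blast
  then show ?thesis
    unfolding ecc_spectrum_def using eigenvalue_ecc_mat_iff[of _ G x] by blast
qed

text \<open>Finiteness gives \<open>Max\<close> in \<open>xi1\<close> its meaning; eigenvalues are
  roots of the nonzero characteristic polynomial.\<close>

lemma finite_ecc_spectrum:
  assumes "finite (pverts G)"
  shows "finite (ecc_spectrum G)"
proof -
  obtain vs where vs: "distinct vs" "set vs = pverts G"
    using finite_distinct_list[OF assms] by blast
  let ?A = "ecc_mat vs G"
  have A: "?A \<in> carrier_mat (length vs) (length vs)" by (simp add: ecc_mat_def)
  have "ecc_spectrum G \<subseteq> {x. poly (char_poly ?A) x = 0}"
  proof
    fix x assume "x \<in> ecc_spectrum G"
    then have "eigenvalue ?A x"
      using ecc_spectrum_iff[OF assms] eigenvalue_ecc_mat_iff[OF vs] by blast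
    then show "x \<in> {x. poly (char_poly ?A) x = 0}"
      using eigenvalue_root_char_poly[OF A] by simp
  qed
  moreover have "char_poly ?A \<noteq> 0"
    using degree_monic_char_poly[OF A] by auto
  ultimately show ?thesis
    using poly_roots_finite finite_subset by blast
qed

lemma complement_spectrum_iff:
  assumes "square_free_graph (pverts G) (parcs G)"
  shows "x \<in> ecc_spectrum (graph_complement G) \<longleftrightarrow>
    (\<exists>f. (\<exists>v\<in>pverts G. f v \<noteq> 0) \<and>
       (\<forall>u\<in>pverts G. (\<Sum>v\<in>pverts G. codist_entry (pverts G) (parcs G) u v * f v) = x * f u))"
proof -
  have V: "pverts (graph_complement G) = pverts G" by (simp add: graph_complement_def)
  have "(\<Sum>v\<in>pverts G. ecc_entry (graph_complement G) u v * f v)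
      = (\<Sum>v\<in>pverts G. codist_entry (pverts G) (parcs G) u v * f v)" if "u \<in> pverts G" for u f
    using that by (intro sum.cong refl) (simp add: ecc_entry_complement[OF assms])
  then show ?thesis
    using ecc_spectrum_iff[of "graph_complement G" x] square_free_graph.finite_V[OF assms]
    by (simp add: V)
qed

lemma finite_complement_spectrum:
  "square_free_graph (pverts G) (parcs G) \<Longrightarrow> finite (ecc_spectrum (graph_complement G))"
  by (rule finite_ecc_spectrum) (simp add: graph_complement_def square_free_graph.finite_V)

lemma codist_image:
  assumes bij: "bij_betw \<phi> V V'"
    and E: "\<And>u v. \<lbrakk>u \<in> V; v \<in> V\<rbrakk> \<Longrightarrow> (u, v) \<in> E \<longleftrightarrow> (\<phi> u, \<phi> v) \<in> E'"
    and uv: "u \<in> V" "v \<in> V"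
  shows "codist V' E' (\<phi> u) (\<phi> v) = codist V E u v"
proof -
  have V': "V' = \<phi> ` V" and eq: "\<And>u v. \<lbrakk>u \<in> V; v \<in> V\<rbrakk> \<Longrightarrow> \<phi> u = \<phi> v \<longleftrightarrow> u = v"
    using bij by (auto simp: bij_betw_def inj_on_eq_iff)
  show ?thesis using uv by (simp add: codist_def V' E eq)
qed

lemma codist_entry_image:
  assumes bij: "bij_betw \<phi> V V'"
    and E: "\<And>u v. \<lbrakk>u \<in> V; v \<in> V\<rbrakk> \<Longrightarrow> (u, v) \<in> E \<longleftrightarrow> (\<phi> u, \<phi> v) \<in> E'"
    and uv: "u \<in> V" "v \<in> V"
  shows "codist_entry V' E' (\<phi> u) (\<phi> v) = codist_entry V E u v"
proof -
  have "codist V' E' (\<phi> w) ` V' = codist V E w ` V" if "w \<in> V" for w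
  proof -
    have "codist V' E' (\<phi> w) ` V' = (\<lambda>v. codist V' E' (\<phi> w) (\<phi> v)) ` V"
      using bij by (auto simp: bij_betw_def)
    also have "\<dots> = codist V E w ` V"
      using that by (intro image_cong refl codist_image[OF bij E])
    finally show ?thesis .
  qed
  then show ?thesis
    using uv codist_image[OF bij E uv] by (simp add: codist_entry_def)
qed

lemma complement_spectrum_mono_iso:
  assumes G: "square_free_graph (pverts G) (parcs G)" and H: "square_free_graph (pverts H) (parcs H)"
    and bij: "bij_betw \<phi> (pverts G) (pverts H)"
    and E: "\<And>u v. \<lbrakk>u \<in> pverts G; v \<in> pverts G\<rbrakk> \<Longrightarrow> (u, v) \<in> parcs G \<longleftrightarrow> (\<phi> u, \<phi> v) \<in> parcs H"
  shows "ecc_spectrum (graph_complement H) \<subseteq> ecc_spectrum (graph_complement G)"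
proof
  fix x assume "x \<in> ecc_spectrum (graph_complement H)"
  then obtain f where f: "\<exists>v\<in>pverts H. f v \<noteq> 0"
    "\<And>u. u \<in> pverts H \<Longrightarrow> (\<Sum>v\<in>pverts H. codist_entry (pverts H) (parcs H) u v * f v) = x * f u"
    unfolding complement_spectrum_iff[OF H] by blast
  have im: "pverts H = \<phi> ` pverts G" using bij by (simp add: bij_betw_def)
  have "(\<Sum>v\<in>pverts G. codist_entry (pverts G) (parcs G) u v * (f \<circ> \<phi>) v) = x * (f \<circ> \<phi>) u"
    if u: "u \<in> pverts G" for u
  proof -
    have "(\<Sum>v\<in>pverts G. codist_entry (pverts G) (parcs G) u v * (f \<circ> \<phi>) v)
        = (\<Sum>v\<in>pverts G. codist_entry (pverts H) (parcs H) (\<phi> u) (\<phi> v) * f (\<phi> v))"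
      using u by (intro sum.cong refl) (simp add: codist_entry_image[OF bij E])
    also have "\<dots> = (\<Sum>v\<in>pverts H. codist_entry (pverts H) (parcs H) (\<phi> u) v * f v)"
      by (rule sum.reindex_bij_betw[OF bij])
    also have "\<dots> = x * f (\<phi> u)" using u im by (intro f(2)) auto
    finally show ?thesis by simp
  qed
  moreover have "\<exists>v\<in>pverts G. (f \<circ> \<phi>) v \<noteq> 0" using f(1) im by auto
  ultimately show "x \<in> ecc_spectrum (graph_complement G)"
    unfolding complement_spectrum_iff[OF G] by blast
qed

lemma inv_into_edge_iff:
  assumes "bij_betw \<phi> V V'" "\<And>u v. \<lbrakk>u \<in> V; v \<in> V\<rbrakk> \<Longrightarrow> (u, v) \<in> E \<longleftrightarrow> (\<phi> u, \<phi> v) \<in> E'"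
    and "u \<in> V'" "v \<in> V'"
  shows "(u, v) \<in> E' \<longleftrightarrow> (inv_into V \<phi> u, inv_into V \<phi> v) \<in> E"
  using assms by (simp add: bij_betw_def inv_into_into f_inv_into_f)

lemma xi1_complement_iso:
  assumes G: "square_free_graph (pverts G) (parcs G)" and H: "square_free_graph (pverts H) (parcs H)"
    and iso: "digraph_iso (with_proj G) (with_proj H)"
    and wf: "pair_wf_digraph G" "pair_wf_digraph H"
  shows "xi1 (graph_complement G) = xi1 (graph_complement H)"
proof -
  obtain \<phi> where bij: "bij_betw \<phi> (pverts G) (pverts H)"
    and E: "\<And>u v. \<lbrakk>u \<in> pverts G; v \<in> pverts G\<rbrakk> \<Longrightarrow> (u, v) \<in> parcs G \<longleftrightarrow> (\<phi> u, \<phi> v) \<in> parcs H"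
    using iso unfolding digraph_iso_pair_iff[OF wf] by blast
  have "ecc_spectrum (graph_complement H) = ecc_spectrum (graph_complement G)"
    using complement_spectrum_mono_iso[OF G H bij E]
      complement_spectrum_mono_iso[OF H G bij_betw_inv_into[OF bij] inv_into_edge_iff[OF bij E]]
    by (intro antisym)
  then show ?thesis by (simp add: xi1_def)
qed

section \<open>The largest eigenvalue for the path\<close>

lemma pair_wf_digraph_path_graph: "pair_wf_digraph (path_graph n)"
  by unfold_locales (auto simp: path_graph_def)

lemma square_free_path_graph:
  assumes "4 \<le> n"
  shows "square_free_graph (pverts (path_graph n)) (parcs (path_graph n))"
proof
  fix u assume "u \<in> pverts (path_graph n)"
  have "\<exists>w\<in>{0, 1, 2, 3}. w \<noteq> u \<and> w \<noteq> Suc u \<and> u \<noteq> Suc w" by auto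
  then show "\<exists>w\<in>pverts (path_graph n). w \<noteq> u \<and> (u, w) \<notin> parcs (path_graph n)"
    using assms by (auto simp: path_graph_def)
qed (auto simp: path_graph_def)

text \<open>With five vertices every edge has a common non-neighbour, so its ends have distance 2 in
  the complement. Every vertex lies on an edge, hence all eccentricities are 2 and the distances 1
  are erased.\<close>

lemma codist_entry_path_graph:
  assumes n: "5 \<le> n" and uv: "u < n" "v < n"
  defines "V \<equiv> pverts (path_graph n)" and "E \<equiv> parcs (path_graph n)"
  shows "codist_entry V E u v = (if (u, v) \<in> E then 2 else 0)"
proof -
  have V: "V = {0..<n}" and E: "(a, b) \<in> E \<longleftrightarrow> a < n \<and> b < n \<and> (b = Suc a \<or> a = Suc b)" for a b
    by (auto simp: V_def E_def path_graph_def)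
  have two: "codist V E a b = (if a = b then 0 else if (a, b) \<in> E then 2 else 1)" for a b
  proof (cases "(a, b) \<in> E")
    case True
    obtain w where "w \<in> {0, 1, 2, 3, 4}" "w \<noteq> a" "w \<noteq> b" "w \<noteq> Suc a" "a \<noteq> Suc w" "w \<noteq> Suc b" "b \<noteq> Suc w"
    proof -
      have "b = Suc a \<or> a = Suc b" using True by (simp add: E)
      \<comment> \<open>An edge among the vertices 0, 1, 2 has the common non-neighbour 4; an edge
        with both ends from 2 on has 0. On four vertices the middle edge has none.\<close>
      then consider "a \<le> 1" "b \<le> 2" | "a \<le> 2" "b \<le> 1" | "2 \<le> a" "2 \<le> b"
        by linarith
      then show ?thesis
        using that[of 4] that[of 0] by cases auto
    qed
    then have "w \<in> V \<and> w \<noteq> a \<and> w \<noteq> b \<and> (a, w) \<notin> E \<and> (b, w) \<notin> E"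
      using n by (auto simp: V E)
    then show ?thesis unfolding codist_def using True by auto
  qed (simp add: codist_def)
  have ecc: "Max (codist V E a ` V) = 2" if "a < n" for a
  proof (rule Max_eqI)
    show "finite (codist V E a ` V)" by (simp add: V)
    show "y \<le> 2" if "y \<in> codist V E a ` V" for y using that by (auto simp: two)
    have "\<exists>b\<in>V. (a, b) \<in> E"
      using that n by (cases a) (auto simp: V E)
    then show "2 \<in> codist V E a ` V"
      by (force simp: two E)
  qed
  show ?thesis
    using ecc[OF uv(1)] ecc[OF uv(2)] by (auto simp: codist_entry_def two E)
qed

text \<open>The sine addition formula handles the inner vertices. At the two ends the missing
  neighbour would carry \<open>sin 0\<close> or \<open>sin pi\<close>, so the formula persists;
  \<open>Suc i\<close> shifts the numbering from 0 to the positions 1 to \<open>n\<close>.\<close>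

lemma sum_path_neighbours:
  fixes f :: "nat \<Rightarrow> real"
  assumes u: "u < n" and \<theta>: "\<theta> = pi / real (Suc n)"
  defines "f \<equiv> \<lambda>i. sin (real (Suc i) * \<theta>)"
  shows "(\<Sum>v | (u, v) \<in> parcs (path_graph n). f v) = 2 * cos \<theta> * f u"
proof -
  have \<theta>n: "real (Suc n) * \<theta> = pi" by (simp add: \<theta> del: of_nat_Suc)
  have "{v. (u, v) \<in> parcs (path_graph n)} = (if u = 0 then {} else {u - 1}) \<union> (if Suc u < n then {Suc u} else {})"
    using u by (auto simp: path_graph_def)
  then have "(\<Sum>v | (u, v) \<in> parcs (path_graph n). f v)
      = (if u = 0 then 0 else f (u - 1)) + (if Suc u < n then f (Suc u) else 0)"
    by auto
  moreover have "(if u = 0 then 0 else f (u - 1)) = sin (real (Suc u) * \<theta> - \<theta>)"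
    by (auto simp: f_def algebra_simps)
  moreover have "(if Suc u < n then f (Suc u) else 0) = sin (real (Suc u) * \<theta> + \<theta>)"
  proof (cases "Suc u < n")
    case False
    then have "Suc u = n" using u by simp
    then have "real (Suc u) * \<theta> + \<theta> = pi" using \<theta>n by (simp add: algebra_simps)
    then show ?thesis using False by simp
  qed (simp add: f_def algebra_simps)
  ultimately show ?thesis
    by (simp add: f_def sin_add sin_diff del: of_nat_Suc)
qed

text \<open>The sine vector is a positive eigenvector of twice the adjacency matrix, so no
  eigenvalue exceeds its own.\<close>

lemma xi1_complement_path_graph:
  assumes n: "5 \<le> n"
  shows "xi1 (graph_complement (path_graph n)) = 4 * cos (pi / real (Suc n))"
proof -
  let ?V = "pverts (path_graph n)" and ?E = "parcs (path_graph n)"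
  define \<theta> where "\<theta> = pi / real (Suc n)"
  define f where "f i = sin (real (Suc i) * \<theta>)" for i
  have G: "square_free_graph ?V ?E" using n by (intro square_free_path_graph) simp
  have V: "?V = {0..<n}" by (simp add: path_graph_def)
  have \<theta>0: "0 < \<theta>" and \<theta>n: "real (Suc n) * \<theta> = pi" by (simp_all add: \<theta>_def del: of_nat_Suc)
  have pos: "0 < f i" if "i \<in> ?V" for i
  proof -
    have "real (Suc i) * \<theta> < real (Suc n) * \<theta>"
      using that \<theta>0 by (intro mult_strict_right_mono) (auto simp: V)
    then have "real (Suc i) * \<theta> < pi" unfolding \<theta>n .
    then show ?thesis unfolding f_def using \<theta>0 by (intro sin_gt_zero) auto
  qed
  have eig: "(\<Sum>v\<in>?V. codist_entry ?V ?E u v * f v) = (4 * cos \<theta>) * f u" if "u \<in> ?V" for u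
  proof -
    have "(\<Sum>v\<in>?V. codist_entry ?V ?E u v * f v) = (\<Sum>v\<in>?V. if (u, v) \<in> ?E then 2 * f v else 0)"
    proof (intro sum.cong refl)
      fix v assume "v \<in> ?V"
      then have "codist_entry ?V ?E u v = (if (u, v) \<in> ?E then 2 else 0)"
        using that n by (intro codist_entry_path_graph) (auto simp: V)
      then show "codist_entry ?V ?E u v * f v = (if (u, v) \<in> ?E then 2 * f v else 0)"
        by simp
    qed
    also have "\<dots> = (\<Sum>v | (u, v) \<in> ?E. 2 * f v)"
      by (intro sum.mono_neutral_cong_right) (auto simp: V path_graph_def)
    also have "\<dots> = 2 * (2 * cos \<theta> * f u)"
      unfolding sum_distrib_left[symmetric] f_def
      using sum_path_neighbours[of u n \<theta>] that by (simp add: \<theta>_def V del: of_nat_Suc)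
    finally show ?thesis by simp
  qed
  have "Max (ecc_spectrum (graph_complement (path_graph n))) = 4 * cos \<theta>"
  proof (rule Max_eqI[OF finite_complement_spectrum[OF G]])
    have "0 \<in> ?V" using n by (simp add: V)
    then have "\<exists>v\<in>?V. f v \<noteq> 0" using pos[of 0] by (intro bexI[of _ 0]) auto
    then show "4 * cos \<theta> \<in> ecc_spectrum (graph_complement (path_graph n))"
      unfolding complement_spectrum_iff[OF G] using eig by blast
    fix x assume "x \<in> ecc_spectrum (graph_complement (path_graph n))"
    then obtain h where "\<exists>v\<in>?V. h v \<noteq> 0" "\<And>u. u \<in> ?V \<Longrightarrow> (\<Sum>v\<in>?V. codist_entry ?V ?E u v * h v) = x * h u"
      unfolding complement_spectrum_iff[OF G] by blast
    then show "x \<le> 4 * cos \<theta>"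
      using pos eig
      by (intro eigenvalue_le_of_positive_supersolution[of ?V "codist_entry ?V ?E" f "4 * cos \<theta>" h x])
        (auto simp: codist_entry_nonneg V)
  qed
  then show ?thesis by (simp add: xi1_def \<theta>_def)
qed

section \<open>Trees with a branch vertex\<close>

lemma xi1_complement_branch_vertex:
  assumes T: "acyclic_connected (pverts T) (parcs T)" and G: "square_free_graph (pverts T) (parcs T)"
    and c: "(c, x) \<in> parcs T" "(c, y) \<in> parcs T" "(c, z) \<in> parcs T" "x \<noteq> y" "x \<noteq> z" "y \<noteq> z"
  shows "4 * cos (pi / real (Suc (card (pverts T)))) < xi1 (graph_complement T)"
proof -
  interpret acyclic_connected "pverts T" "parcs T" by fact
  let ?V = "pverts T" and ?E = "parcs T"
  let ?M = "codist_entry ?V ?E"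
  define \<theta> where "\<theta> = pi / real (Suc (card ?V))"
  have cV: "c \<in> ?V" using c E_sub by auto
  obtain f where f: "\<And>u. u \<in> ?V \<Longrightarrow> 0 < f u"
    and ge: "\<And>u. u \<in> ?V \<Longrightarrow> 2 * cos \<theta> * f u \<le> (\<Sum>v | (u, v) \<in> ?E. f v)"
    and gt: "2 * cos \<theta> * f c < (\<Sum>v | (c, v) \<in> ?E. f v)"
    using branch_vertex_test_vector[OF c \<theta>_def] by metis
  \<comment> \<open>The eigenvector \<open>h\<close> only certifies that \<open>\<mu>\<close> lies
    in the spectrum; the estimate applies \<open>form\<close> to the test vector
    \<open>f\<close>.\<close>
  obtain \<mu> h where h: "\<exists>v\<in>?V. h v \<noteq> 0" "\<And>u. u \<in> ?V \<Longrightarrow> (\<Sum>v\<in>?V. ?M u v * h v) = \<mu> * h u"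
    and form: "\<And>h. (\<Sum>u\<in>?V. h u * (\<Sum>v\<in>?V. ?M u v * h v)) \<le> \<mu> * (\<Sum>u\<in>?V. (h u)\<^sup>2)"
    by (rule symmetric_top_eigenvector[of ?V ?M])
      (use cV finite_V square_free_graph.codist_entry_sym[OF G] in blast)+
  have "\<mu> \<in> ecc_spectrum (graph_complement T)"
    unfolding complement_spectrum_iff[OF G] using h by blast
  then have "\<mu> \<le> xi1 (graph_complement T)"
    unfolding xi1_def by (rule Max_ge[OF finite_complement_spectrum[OF G]])
  moreover have "4 * cos \<theta> < \<mu>"
  proof -
    \<comment> \<open>Edge entries are at least 2, and the remaining ones are nonnegative, so
      dropping them can only lower the sum against the positive \<open>f\<close>.\<close>
    have row: "2 * (\<Sum>v | (u, v) \<in> ?E. f v) \<le> (\<Sum>v\<in>?V. ?M u v * f v)" for u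
    proof -
      have "2 * (\<Sum>v | (u, v) \<in> ?E. f v) \<le> (\<Sum>v | (u, v) \<in> ?E. ?M u v * f v)"
        unfolding sum_distrib_left
      proof (intro sum_mono mult_right_mono)
        fix v assume "v \<in> {v. (u, v) \<in> ?E}"
        then show "2 \<le> ?M u v" "0 \<le> f v"
          using codist_entry_edge_ge[OF T G, of u v] f[of v] E_sub by auto
      qed
      also have "\<dots> \<le> (\<Sum>v\<in>?V. ?M u v * f v)"
      proof (rule sum_mono2[OF finite_V])
        show "{v. (u, v) \<in> ?E} \<subseteq> ?V" using E_sub by blast
        show "0 \<le> ?M u v * f v" if "v \<in> ?V - {v. (u, v) \<in> ?E}" for v
          using that f[of v] by (intro mult_nonneg_nonneg codist_entry_nonneg) auto
      qed
      finally show ?thesis .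
    qed
    have "4 * cos \<theta> * (\<Sum>u\<in>?V. (f u)\<^sup>2) = (\<Sum>u\<in>?V. f u * (2 * (2 * cos \<theta> * f u)))"
      by (simp add: sum_distrib_left power2_eq_square mult_ac)
    \<comment> \<open>Weighting with \<open>f c > 0\<close> carries the strict inequality at
      \<open>c\<close> over to the whole sum.\<close>
    also have "\<dots> < (\<Sum>u\<in>?V. f u * (2 * (\<Sum>v | (u, v) \<in> ?E. f v)))"
    proof (rule sum_strict_mono_ex1[OF finite_V])
      show "\<forall>u\<in>?V. f u * (2 * (2 * cos \<theta> * f u)) \<le> f u * (2 * (\<Sum>v | (u, v) \<in> ?E. f v))"
      proof
        fix u assume u: "u \<in> ?V"
        then show "f u * (2 * (2 * cos \<theta> * f u)) \<le> f u * (2 * (\<Sum>v | (u, v) \<in> ?E. f v))"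
          using ge[OF u] f[OF u] by (intro mult_left_mono) auto
      qed
      have "f c * (2 * (2 * cos \<theta> * f c)) < f c * (2 * (\<Sum>v | (c, v) \<in> ?E. f v))"
        using gt f[OF cV] by (intro mult_strict_left_mono) auto
      then show "\<exists>u\<in>?V. f u * (2 * (2 * cos \<theta> * f u)) < f u * (2 * (\<Sum>v | (u, v) \<in> ?E. f v))"
        using cV by blast
    qed
    also have "\<dots> \<le> (\<Sum>u\<in>?V. f u * (\<Sum>v\<in>?V. ?M u v * f v))"
    proof (rule sum_mono)
      fix u assume "u \<in> ?V"
      then show "f u * (2 * (\<Sum>v | (u, v) \<in> ?E. f v)) \<le> f u * (\<Sum>v\<in>?V. ?M u v * f v)"
        using row[of u] f[of u] by (intro mult_left_mono) auto
    qed
    also have "\<dots> \<le> \<mu> * (\<Sum>u\<in>?V. (f u)\<^sup>2)" by (rule form)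
    finally have "4 * cos \<theta> * (\<Sum>u\<in>?V. (f u)\<^sup>2) < \<mu> * (\<Sum>u\<in>?V. (f u)\<^sup>2)" .
    moreover have "0 \<le> (\<Sum>u\<in>?V. (f u)\<^sup>2)" by (intro sum_nonneg) auto
    ultimately show ?thesis by (simp add: mult_less_cancel_right)
  qed
  ultimately show ?thesis by (simp add: \<theta>_def)
qed

theorem theorem3p4:
  fixes T :: "'a pair_pre_digraph" and n :: nat
  assumes "undirected_tree T" and "card (pverts T) = n" and "n \<ge> 4"
    and "\<not> complete_bipartite_digraph 1 (n - 1) (with_proj T)"
  shows "xi1 (graph_complement T) \<ge> xi1 (graph_complement (path_graph n)) \<and>
    (xi1 (graph_complement T) = xi1 (graph_complement (path_graph n)) \<longleftrightarrow>
       digraph_iso (with_proj T) (with_proj (path_graph n)))"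
proof -
  let ?P = "path_graph n"
  interpret pair_graph T using assms(1) by (simp add: undirected_tree_def)
  have T: "acyclic_connected (pverts T) (parcs T)"
    by (rule acyclic_connected_undirected_tree) fact
  interpret A: acyclic_connected "pverts T" "parcs T" by (rule T)
  have dom: "\<exists>w\<in>pverts T. w \<noteq> u \<and> (u, w) \<notin> parcs T" if "u \<in> pverts T" for u
    using no_dominating_vertex[OF T assms(2,4) that] .
  have G: "square_free_graph (pverts T) (parcs T)"
    by unfold_locales (use A.finite_V A.E_sub A.E_sym A.E_irrefl A.no_square dom in blast)+
  have P: "square_free_graph (pverts ?P) (parcs ?P)"
    by (rule square_free_path_graph) fact
  have wfT: "pair_wf_digraph T" by unfold_locales
  note iso_eq = xi1_complement_iso[OF G P _ wfT pair_wf_digraph_path_graph]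
  have ne: "pverts T \<noteq> {}" using assms(2,3) by auto
  from ne show ?thesis
  proof (cases rule: A.path_or_branch_vertex)
    case (path \<phi>)
    have bij: "bij_betw \<phi> (pverts ?P) (pverts T)"
      using path(1) assms(2) by (simp add: path_graph_def)
    have E: "(i, j) \<in> parcs ?P \<longleftrightarrow> (\<phi> i, \<phi> j) \<in> parcs T" if "i \<in> pverts ?P" "j \<in> pverts ?P" for i j
      using path(2)[of i j] that assms(2) by (auto simp: path_graph_def)
    have "digraph_iso (with_proj T) (with_proj ?P)"
      unfolding digraph_iso_pair_iff[OF wfT pair_wf_digraph_path_graph]
      using bij_betw_inv_into[OF bij] inv_into_edge_iff[OF bij E] by blast
    \<comment> \<open>Both sides of the equivalence are true, and the inequality is an
      equality.\<close>
    then show ?thesis using iso_eq by simp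
  next
    case (branch c x y z)
    have V: "c \<in> pverts T" "x \<in> pverts T" "y \<in> pverts T" "z \<in> pverts T"
      using branch A.E_sub by auto
    \<comment> \<open>The non-neighbour \<open>w\<close> is a fifth vertex besides \<open>c\<close>
      and its three neighbours, which makes the closed form for the path available.\<close>
    obtain w where w: "w \<in> pverts T" "w \<noteq> c" "(c, w) \<notin> parcs T" using dom V(1) by blast
    have "card {c, x, y, z, w} = 5"
    proof -
      have "c \<notin> {x, y, z, w}" "w \<notin> {x, y, z}"
        using branch w A.E_irrefl by auto
      then show ?thesis using branch by auto
    qed
    moreover have "card {c, x, y, z, w} \<le> n"
      unfolding assms(2)[symmetric] using V w A.finite_V by (intro card_mono) auto
    ultimately have "5 \<le> n" by simp
    then have "xi1 (graph_complement ?P) < xi1 (graph_complement T)"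
      using xi1_complement_branch_vertex[OF T G branch] xi1_complement_path_graph[of n] assms(2)
      by simp
    \<comment> \<open>An isomorphism would give equality, against the strict inequality, so both
      sides of the equivalence are false.\<close>
    then show ?thesis using iso_eq by auto
  qed
qed

end
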